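(* Let $n\geq 2$ and let $\Gamma$ be a finite connected graph equipped with a free left action $\tau_{\mathbb{Z}_n}\colon \mathbb{Z}_n\times\Gamma\to\Gamma$. (1) If $I=[0,1]$ is the unit interval, then the triple $(\Gamma,\tau_{\mathbb{Z}_n},I)$ satisfies the Borsuk--Ulam property. (2) If $G$ is a finite tree, not reduced to a single point, that is not homeomorphic to $I$, then the Borsuk--Ulam property with respect to $\tau_{\mathbb{Z}_n}$ fails for the unique homotopy class in $[\Gamma,G]$; i.e., that class has a representative $f\colon\Gamma\to G$ such that $f(\tau_{\mathbb{Z}_n}(h_1,x))\neq f(\tau_{\mathbb{Z}_n}(h_2,x))$ for all $x\in\Gamma$ and all $h_1\neq h_2$ in $\mathbb{Z}_n$.
   Context: $\mathbb{Z}_n$ is the cyclic group of order $n$. Graphs are finite, connected, and regarded as topological spaces (finite 1-dimensional CW complexes); actions are continuous. Spaces have base points, $[\Gamma,G]$ denotes the set of based homotopy classes of based maps, and a representative of a class is a based map. (Actions are not required to preserve base points.) For a finite group $H$ acting freely on the left on $X$ via $\tau_H\colon H\times X\to X$, a homotopy class $\alpha$ of maps $X\to Y$ has the Borsuk--Ulam property with respect to $\tau_H$ if for every representative $f$ of $\alpha$ there exist $x\in X$ and $h_1\neq h_2$ in $H$ with $f(\tau_H(h_1,x))=f(\tau_H(h_2,x))$; otherwise the property is said to fail for $\alpha$. The triple $(X,\tau_H,Y)$ satisfies the Borsuk--Ulam property if every homotopy class of maps from $X$ to $Y$ has it. *)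

theory Defs
  imports "HOL-Analysis.Analysis" "HOL-Algebra.Group_Action" "HOL-Algebra.Elementary_Groups"
begin

text \<open>
  A finite graph is a finite CW complex of dimension at most 1, given by its 0-cells \<open>V\<close> and the
  characteristic maps \<open>E\<close> of its 1-cells; loops, multiple edges and a single vertex are allowed.
  Only the topological space is retained, not a particular cell structure.
  In a Hausdorff space with finitely many cells the usual further requirements (a characteristic map
  embeds its open cell, closure-finiteness, weak topology) follow by compactness of \<open>{0..1}\<close>.
\<close>

definition finite_graph :: "'a topology \<Rightarrow> bool" where
  "finite_graph X \<longleftrightarrow> Hausdorff_space X \<and>
     (\<exists>V (E :: (real \<Rightarrow> 'a) set).
        finite V \<and> finite E \<and> V \<subseteq> topspace X \<and>
        (\<forall>e\<in>E. continuous_map (top_of_set {0..1}) X e \<and> e 0 \<in> V \<and> e 1 \<in> V \<and>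
               inj_on e {0<..<1} \<and> e ` {0<..<1} \<inter> V = {}) \<and>
        pairwise (\<lambda>e e'. e ` {0<..<1} \<inter> e' ` {0<..<1} = {}) E \<and>
        topspace X = V \<union> (\<Union>e\<in>E. e ` {0<..<1}))"

text \<open>A tree is a nonempty connected graph without cycles; a cycle of a graph, viewed as a space, is
  an embedded circle.\<close>

definition finite_tree :: "'a topology \<Rightarrow> bool" where
  "finite_tree X \<longleftrightarrow> finite_graph X \<and> topspace X \<noteq> {} \<and> connected_space X \<and>
     \<not> (\<exists>S \<subseteq> topspace X. subtopology X S homeomorphic_space top_of_set (sphere (0::complex) 1))"

text \<open>
  In \<open>group_action\<close> the maps \<open>\<tau> h\<close> are extensional, i.e. \<open>undefined\<close> outside \<open>topspace X\<close>; this only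
  fixes irrelevant values.  The acting (finite) group carries the discrete topology.
\<close>

definition free_continuous_action ::
    "('g, 'm) monoid_scheme \<Rightarrow> 'a topology \<Rightarrow> ('g \<Rightarrow> 'a \<Rightarrow> 'a) \<Rightarrow> bool" where
  "free_continuous_action H X \<tau> \<longleftrightarrow>
     group_action H (topspace X) \<tau> \<and>
     continuous_map (prod_topology (discrete_topology (carrier H)) X) X (\<lambda>(h, x). \<tau> h x) \<and>
     (\<forall>x\<in>topspace X. stabilizer H \<tau> x = {\<one>\<^bsub>H\<^esub>})"

definition based_map :: "'a topology \<Rightarrow> 'a \<Rightarrow> 'b topology \<Rightarrow> 'b \<Rightarrow> ('a \<Rightarrow> 'b) \<Rightarrow> bool" where
  "based_map X x0 Y y0 f \<longleftrightarrow> continuous_map X Y f \<and> f x0 = y0"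

text \<open>
  The set \<open>[X, Y]\<close> of based homotopy classes; each class is the set of its representatives.  Functions
  agreeing on \<open>topspace X\<close> always lie in the same class.
\<close>

definition based_homotopy_classes ::
    "'a topology \<Rightarrow> 'a \<Rightarrow> 'b topology \<Rightarrow> 'b \<Rightarrow> ('a \<Rightarrow> 'b) set set" where
  "based_homotopy_classes X x0 Y y0 =
     {f. based_map X x0 Y y0 f} //
     {(f, g). based_map X x0 Y y0 f \<and> based_map X x0 Y y0 g \<and>
              homotopic_with (\<lambda>k. k x0 = y0) X Y f g}"

definition borsuk_ulam_class ::
    "('g, 'm) monoid_scheme \<Rightarrow> 'a topology \<Rightarrow> ('g \<Rightarrow> 'a \<Rightarrow> 'a) \<Rightarrow> ('a \<Rightarrow> 'b) set \<Rightarrow> bool" where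
  "borsuk_ulam_class H X \<tau> \<alpha> \<longleftrightarrow>
     (\<forall>f\<in>\<alpha>. \<exists>x\<in>topspace X. \<exists>h1\<in>carrier H. \<exists>h2\<in>carrier H.
        h1 \<noteq> h2 \<and> f (\<tau> h1 x) = f (\<tau> h2 x))"

definition borsuk_ulam_triple ::
    "('g, 'm) monoid_scheme \<Rightarrow> 'a topology \<Rightarrow> 'a \<Rightarrow> ('g \<Rightarrow> 'a \<Rightarrow> 'a) \<Rightarrow> 'b topology \<Rightarrow> 'b \<Rightarrow> bool" where
  "borsuk_ulam_triple H X x0 \<tau> Y y0 \<longleftrightarrow>
     (\<forall>\<alpha>\<in>based_homotopy_classes X x0 Y y0. borsuk_ulam_class H X \<tau> \<alpha>)"

end

(* Part (1): if f : \<Gamma> \<rightarrow> \<real> had f (g x) \<noteq> f x everywhere for a generator g, then by connectedness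
   f would be strictly monotone along every orbit, which is impossible as g has finite order.

   Part (2): let W be an n-periodic map of the line into G such that W t, W (t + 1), ..., W (t + n - 1)
   are always distinct, and let \<phi> : \<Gamma> \<rightarrow> \<real>/n\<int> be continuous and shifted by 1 under the generator.
   Then f = W \<circ> \<phi> separates orbits.  Such a \<phi> is given by equivariant integer labels at an invariant
   finite set of vertices, interpolated along one edge of each orbit of edges.  For W one needs a
   branch point of G: n tokens on a tripod can be rotated cyclically without ever colliding.

   A finite tree is built up from its base point by attaching arcs at one end.  Each such step
   preserves contractibility relative to the base point, and the space stays a point or an arc unless a
   tripod through the base point appears. *)

theory Submission
  imports Defs
begin

section \<open>Arcs and tripods\<close>

text \<open>The base points dictate the shape of part (2). A based representative needs f x0 = y0,
  so the tripod must contain y0 and the periodic map must start there; this is why trees are grown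
  from the base point and why contractions keep it fixed. The obstacle in constructing the map to
  the circle is that vertex labels, and the exponent k in x = act k (e t), are determined only
  modulo n. Real lifts are therefore chosen arbitrarily, and only their composite with W, which does
  not see the choice, is shown to be continuous and compatible with the action. That one edge of
  each orbit can be prescribed freely rests on part (1) again: its argument, applied to an invariant
  open edge with the edge coordinate as the real function, yields a fixed point of the
  action.\<close>

definition arc_in :: "'a topology \<Rightarrow> (real \<Rightarrow> 'a) \<Rightarrow> bool" where
  "arc_in X a \<longleftrightarrow> continuous_map (top_of_set {0..1}) X a \<and> inj_on a {0..1}"

lemma arc_in_image_subset: "arc_in X a \<Longrightarrow> a ` {0..1} \<subseteq> topspace X"
  by (auto simp: arc_in_def continuous_map_def)

text \<open>Since s > t is allowed, this covers reversal (s = 1, t = 0) and the two halves of an arc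
  that both start at an interior point.\<close>

lemma arc_in_subarc:
  assumes "arc_in X a" "s \<in> {0..1}" "t \<in> {0..1}" "s \<noteq> t"
  shows "arc_in X (\<lambda>r. a ((1 - r) * s + r * t))"
    and "(\<lambda>r. a ((1 - r) * s + r * t)) ` {0..1} = a ` closed_segment s t"
proof -
  have seg: "(\<lambda>r. (1 - r) * s + r * t) ` {0..1} = closed_segment s t"
    by (auto simp: closed_segment_def)
  then show "(\<lambda>r. a ((1 - r) * s + r * t)) ` {0..1} = a ` closed_segment s t"
    by (metis image_image)
  have sub: "closed_segment s t \<subseteq> {0..1}"
    using assms(2,3) by (auto simp: closed_segment_eq_real_ivl)
  have "continuous_map (top_of_set {0..1}) (top_of_set {0..1}) (\<lambda>r. (1 - r) * s + r * t)"
    using seg sub by (auto intro!: continuous_intros simp: continuous_map_in_subtopology)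
  then have "continuous_map (top_of_set {0..1}) X (a \<circ> (\<lambda>r. (1 - r) * s + r * t))"
    using assms(1) unfolding arc_in_def by (blast intro: continuous_map_compose)
  moreover have "inj_on (\<lambda>r. a ((1 - r) * s + r * t)) {0..1}"
  proof (rule inj_onI)
    fix r r' :: real
    assume r: "r \<in> {0..1}" "r' \<in> {0..1}" "a ((1 - r) * s + r * t) = a ((1 - r') * s + r' * t)"
    have "(1 - r) * s + r * t \<in> {0..1}" "(1 - r') * s + r' * t \<in> {0..1}"
      using seg sub r(1,2) by blast+
    with r(3) assms(1) have "(1 - r) * s + r * t = (1 - r') * s + r' * t"
      by (auto simp: arc_in_def inj_on_def)
    then have "(r - r') * (t - s) = 0" by algebra
    with \<open>s \<noteq> t\<close> show "r = r'" by simp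
  qed
  ultimately show "arc_in X (\<lambda>r. a ((1 - r) * s + r * t))"
    by (simp add: arc_in_def o_def)
qed

lemma arc_in_reverse: "arc_in X a \<Longrightarrow> arc_in X (\<lambda>r. a (1 - r))"
  using arc_in_subarc(1)[of X a 1 0] by simp

lemma reverse_image: "(\<lambda>r. a (1 - r)) ` {0..1::real} = a ` {0..1}"
proof -
  have "(\<lambda>r::real. 1 - r) ` {0..1} = {0..1}" by (auto simp: image_iff intro!: bexI[of _ "1 - _"])
  then show ?thesis by (metis image_image)
qed

lemma arc_in_continuous_on_subset:
  "arc_in X a \<Longrightarrow> S \<subseteq> {0..1} \<Longrightarrow> continuous_map (top_of_set S) X a"
  using arc_in_def continuous_map_from_subtopology_mono by blast

text \<open>The junction sits at 0, so points of the union get a signed coordinate, positive along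
  \<open>a\<close> and negative along \<open>c\<close>. Tokens are later moved in this coordinate,
  and rescaling it joins two arcs.\<close>

lemma bidirectional_arc:
  assumes a: "arc_in X a" and c: "arc_in X c" and ac: "a 0 = c 0"
    and meet: "a ` {0..1} \<inter> c ` {0..1} = {a 0}"
  defines "L \<equiv> \<lambda>s. if 0 \<le> s then a s else c (- s)"
  shows "continuous_map (top_of_set {-1..1}) X L" and "inj_on L {-1..1}"
    and "L ` {-1..1} = a ` {0..1} \<union> c ` {0..1}"
proof -
  show "continuous_map (top_of_set {-1..1}) X L"
    unfolding L_def
  proof (rule continuous_map_cases_le[where p = "\<lambda>_. 0" and q = "\<lambda>s. s" and f = a and g = "\<lambda>s. c (- s)"])
    show "continuous_map (subtopology (top_of_set {-1..1}) {x \<in> topspace (top_of_set {- 1..1::real}). 0 \<le> x}) X a"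
      unfolding subtopology_subtopology by (rule arc_in_continuous_on_subset[OF a]) auto
    have "continuous_map (top_of_set {-1..0}) X (c \<circ> uminus)"
      by (rule continuous_map_compose[of _ "top_of_set {0..1}"])
        (use c in \<open>auto simp: arc_in_def continuous_map_in_subtopology intro!: continuous_intros\<close>)
    moreover have "{- 1..1} \<inter> {x \<in> topspace (top_of_set {- 1..1::real}). x \<le> 0} = {-1..0}" by auto
    ultimately show "continuous_map (subtopology (top_of_set {-1..1}) {x \<in> topspace (top_of_set {- 1..1::real}). x \<le> 0}) X (\<lambda>x. c (- x))"
      unfolding subtopology_subtopology by (simp add: o_def)
  qed (use ac in \<open>auto intro!: continuous_intros\<close>)
  have inja: "\<And>s t. a s = a t \<Longrightarrow> s \<in> {0..1} \<Longrightarrow> t \<in> {0..1} \<Longrightarrow> s = t"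
    and injc: "\<And>s t. c s = c t \<Longrightarrow> s \<in> {0..1} \<Longrightarrow> t \<in> {0..1} \<Longrightarrow> s = t"
    using a c unfolding arc_in_def by (meson inj_onD)+
  have cross: "s = 0 \<and> t = 0" if "a s = c t" "s \<in> {0..1}" "t \<in> {0..1}" for s t
  proof -
    have "a s \<in> a ` {0..1} \<inter> c ` {0..1}" using that by (metis IntI imageI)
    then have "a s = a 0" "c t = c 0" using meet that ac by auto
    then show ?thesis using inja injc that by auto
  qed
  show "inj_on L {-1..1}"
  proof (rule inj_onI)
    fix s t :: real assume st: "s \<in> {-1..1}" "t \<in> {-1..1}" "L s = L t"
    consider "0 \<le> s" "0 \<le> t" | "0 \<le> s" "t < 0" | "s < 0" "0 \<le> t" | "s < 0" "t < 0" by linarith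
    then show "s = t"
    proof cases
      case 1 then show ?thesis using st inja by (auto simp: L_def)
    next
      case 2 then show ?thesis using st cross[of s "-t"] by (auto simp: L_def)
    next
      case 3 then show ?thesis using st cross[of t "-s"] by (auto simp: L_def)
    next
      case 4 then show ?thesis using st injc[of "-s" "-t"] by (auto simp: L_def)
    qed
  qed
  have "{-1..1::real} = {0..1} \<union> {-1..<0}" by auto
  then have "L ` {-1..1} = L ` {0..1} \<union> L ` {-1..<0}" by (metis image_Un)
  moreover have "L ` {0..1} = a ` {0..1}" by (auto simp: L_def)
  moreover have "L ` {-1..<0} = c ` {0<..1}"
  proof -
    have "uminus ` {-1..<0::real} = {0<..1}" by simp
    moreover have "L ` {-1..<0} = c ` (uminus ` {-1..<0})"
      unfolding image_image by (rule image_cong) (auto simp: L_def)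
    ultimately show ?thesis by simp
  qed
  moreover have "c ` {0..1} = insert (c 0) (c ` {0<..1})"
  proof -
    have "{0..1::real} = insert 0 {0<..1}" by auto
    then show ?thesis by (metis image_insert)
  qed
  moreover have "c 0 \<in> a ` {0..1}" unfolding ac[symmetric] by auto
  ultimately show "L ` {-1..1} = a ` {0..1} \<union> c ` {0..1}" by auto
qed

lemma arc_in_join:
  assumes "arc_in X a" "arc_in X c" "a 0 = c 0" "a ` {0..1} \<inter> c ` {0..1} = {a 0}"
  obtains e where "arc_in X e" "e 0 = a 1" "e 1 = c 1" "e ` {0..1} = a ` {0..1} \<union> c ` {0..1}"
proof
  define L where "L = (\<lambda>s. if 0 \<le> s then a s else c (- s))"
  have L: "continuous_map (top_of_set {-1..1}) X L" "inj_on L {-1..1}"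
    "L ` {-1..1} = a ` {0..1} \<union> c ` {0..1}"
    unfolding L_def by (rule bidirectional_arc[OF assms])+
  \<comment> \<open>The orientation is reversed: the joined arc runs from the far end of
    \<open>a\<close> through the junction to the far end of \<open>c\<close>.\<close>
  let ?p = "\<lambda>r::real. 1 - 2 * r"
  have p: "?p ` {0..1} = {-1..1}"
  proof -
    have "x \<in> ?p ` {0..1}" if "x \<in> {-1..1}" for x
      by (rule image_eqI[of _ _ "(1 - x) / 2"]) (use that in \<open>auto simp: field_simps\<close>)
    then show ?thesis by auto
  qed
  have "continuous_map (top_of_set {0..1}) X (L \<circ> ?p)"
    by (rule continuous_map_compose[of _ "top_of_set {-1..1}"])
       (use L p in \<open>auto simp: continuous_map_in_subtopology intro!: continuous_intros\<close>)
  moreover have "inj_on (L \<circ> ?p) {0..1}"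
    by (rule comp_inj_on) (use p L in \<open>auto intro: inj_onI\<close>)
  ultimately show "arc_in X (L \<circ> ?p)" by (simp add: arc_in_def)
  show "(L \<circ> ?p) ` {0..1} = a ` {0..1} \<union> c ` {0..1}"
    using L(3) p by (metis image_comp)
  show "(L \<circ> ?p) 0 = a 1" "(L \<circ> ?p) 1 = c 1" by (auto simp: L_def)
qed

text \<open>Asking for y on the leg \<open>a\<close> loses nothing, as the legs may be permuted. The
  point y must lie on the tripod because the closed trajectory built there has to pass through the
  base point.\<close>

definition tripod_through :: "'a topology \<Rightarrow> 'a \<Rightarrow> bool" where
  "tripod_through X y \<longleftrightarrow> (\<exists>a b c. arc_in X a \<and> arc_in X b \<and> arc_in X c \<and> a 0 = b 0 \<and> a 0 = c 0 \<and>
     a ` {0..1} \<inter> b ` {0..1} = {a 0} \<and> a ` {0..1} \<inter> c ` {0..1} = {a 0} \<and>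
     b ` {0..1} \<inter> c ` {0..1} = {a 0} \<and> y \<in> a ` {0..1})"

section \<open>Periodic maps of the line\<close>

lemma periodic_shift_int:
  fixes p :: real
  assumes "\<And>t. W (t + p) = W t"
  shows "W (t + p * of_int k) = W t"
proof (induction k rule: int_induct[where k = 0])
  case (step1 i) then show ?case using assms[of "t + p * of_int i"] by (simp add: algebra_simps)
next
  case (step2 i) then show ?case using assms[of "t + p * of_int (i - 1)"] by (simp add: algebra_simps)
qed simp

text \<open>Translates of \<open>U\<close> are pasted over the locally finite closed cover of the
  line by the intervals between consecutive multiples of p.\<close>

lemma periodic_extension:
  fixes p :: real
  assumes U: "continuous_map (top_of_set {0..p}) X U" "U 0 = U p" and "p > 0"
  obtains W where "continuous_map euclideanreal X W" "\<And>t. W (t + p) = W t"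
    "\<And>t. t \<in> {0..p} \<Longrightarrow> W t = U t"
proof
  define W where "W t = U (t - p * of_int \<lfloor>t / p\<rfloor>)" for t
  \<comment> \<open>At the right end of an interval the floor has already jumped and gives
    \<open>U 0\<close> instead of \<open>U p\<close>; the hypothesis \<open>U 0 = U p\<close> closes
    this gap.\<close>
  have WU: "W t = U (t - p * of_int j)" if "t \<in> {p * of_int j..p * of_int (j + 1)}" for t and j :: int
  proof (cases "t = p * of_int (j + 1)")
    case True
    then have "W t = U 0" using \<open>p > 0\<close> by (simp add: W_def)
    moreover have "t - p * of_int j = p" using True by (simp add: algebra_simps)
    ultimately show ?thesis using U(2) by simp
  next
    case False
    then have "\<lfloor>t / p\<rfloor> = j" using that \<open>p > 0\<close> by (intro floor_unique) (auto simp: field_simps)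
    then show ?thesis by (simp add: W_def)
  qed
  show "W t = U t" if "t \<in> {0..p}" for t using WU[of t 0] that by simp
  show "W (t + p) = W t" for t
    using \<open>p > 0\<close> by (simp add: W_def add_divide_distrib) (simp add: algebra_simps)
  show "continuous_map euclideanreal X W"
  proof (rule pasting_lemma_locally_finite[where I = UNIV and T = "\<lambda>j::int. {p * of_int j..p * of_int (j + 1)}"
        and f = "\<lambda>j t. U (t - p * of_int j)"])
    fix x :: real
    let ?V = "{x - p<..<x + p}"
    have "{i \<in> UNIV. {p * of_int i..p * of_int (i + 1)} \<inter> ?V \<noteq> {}} \<subseteq> {\<lfloor>x / p\<rfloor> - 2..\<lfloor>x / p\<rfloor> + 2}"
    proof
      fix i :: int assume "i \<in> {i \<in> UNIV. {p * of_int i..p * of_int (i + 1)} \<inter> ?V \<noteq> {}}"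
      then obtain y where "p * of_int i \<le> y" "y \<le> p * (of_int i + 1)" "x - p < y" "y < x + p"
        by auto
      then have "of_int i \<le> y / p" "y / p \<le> of_int i + 1" "(x - p) / p < y / p" "y / p < (x + p) / p"
        using \<open>p > 0\<close> by (auto simp: divide_strict_right_mono) (auto simp: field_simps)
      moreover have "(x - p) / p = x / p - 1" "(x + p) / p = x / p + 1"
        using \<open>p > 0\<close> by (auto simp: field_simps)
      ultimately
      show "i \<in> {\<lfloor>x / p\<rfloor> - 2..\<lfloor>x / p\<rfloor> + 2}" unfolding atLeastAtMost_iff by linarith
    qed
    then have "finite {i \<in> UNIV. {p * of_int i..p * of_int (i + 1)} \<inter> ?V \<noteq> {}}"
      by (rule finite_subset) simp
    then show "\<exists>V. openin euclideanreal V \<and> x \<in> V \<and> finite {i \<in> UNIV. {p * of_int i..p * of_int (i + 1)} \<inter> V \<noteq> {}}"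
      using \<open>p > 0\<close> by (intro exI[of _ ?V]) auto
  next
    fix i :: int
    show "continuous_map (top_of_set {p * of_int i..p * of_int (i + 1)}) X (\<lambda>t. U (t - p * of_int i))"
    proof (rule continuous_map_compose[of _ "top_of_set {0..p}" "\<lambda>t. t - p * of_int i" X U, unfolded o_def])
      show "continuous_map (top_of_set {p * of_int i..p * of_int (i + 1)}) (top_of_set {0..p}) (\<lambda>t. t - p * of_int i)"
        by (auto simp: continuous_map_in_subtopology algebra_simps intro!: continuous_intros)
    qed (rule U)
  next
    fix x :: real
    have "p * of_int \<lfloor>x / p\<rfloor> \<le> p * (x / p)" "p * (x / p) \<le> p * of_int (\<lfloor>x / p\<rfloor> + 1)"
      using \<open>p > 0\<close> by (intro mult_left_mono; linarith)+
    then have "x \<in> {p * of_int \<lfloor>x / p\<rfloor>..p * of_int (\<lfloor>x / p\<rfloor> + 1)}"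
      using \<open>p > 0\<close> by simp
    then show "\<exists>j. j \<in> UNIV \<and> x \<in> {p * of_int j..p * of_int (j + 1)} \<and> W x = U (x - p * of_int j)"
      using WU by blast
  next
    fix i j :: int and x :: real
    assume "x \<in> topspace euclideanreal \<inter> {p * of_int i..p * of_int (i + 1)} \<inter> {p * of_int j..p * of_int (j + 1)}"
    then show "U (x - p * of_int i) = U (x - p * of_int j)" using WU[of x i] WU[of x j] by auto
  qed auto
qed

section \<open>Rotating tokens on a tripod\<close>

text \<open>The distance from t to the nearest integer, in a closed form from which periodicity and
  continuity can be read off.\<close>

definition triangle_wave :: "real \<Rightarrow> real" where
  "triangle_wave t = arccos (cos (2 * pi * t)) / (2 * pi)"

lemma triangle_wave_add_int: "triangle_wave (t + of_int k) = triangle_wave t"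
proof -
  have "cos (2 * pi * (t + of_int k)) = cos (2 * pi * t)"
    using cos_int_2pin[of k] sin_int_2pin[of k] by (simp add: distrib_left cos_add)
  then show ?thesis by (simp add: triangle_wave_def)
qed

lemma triangle_wave_rising: "t \<in> {0..1/2} \<Longrightarrow> triangle_wave t = t"
  by (auto simp: triangle_wave_def arccos_cos)

lemma triangle_wave_falling:
  assumes "t \<in> {1/2..1}" shows "triangle_wave t = 1 - t"
proof -
  have "cos (2 * pi * t) = cos (2 * pi * (1 - t))"
    by (simp add: right_diff_distrib cos_diff)
  then have "triangle_wave t = triangle_wave (1 - t)" by (simp add: triangle_wave_def)
  then show ?thesis using triangle_wave_rising[of "1 - t"] assms by auto
qed

lemma continuous_on_triangle_wave [continuous_intros]:
  fixes f :: "real \<Rightarrow> real"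
  shows "continuous_on S f \<Longrightarrow> continuous_on S (\<lambda>x. triangle_wave (f x))"
  unfolding triangle_wave_def by (intro continuous_intros) auto

text \<open>
  \<open>n\<close> tokens sit on a tripod, one at the centre and the others on the leg \<open>a\<close>.  The central token
  parks on the leg \<open>b\<close> while the others move across the centre into \<open>c\<close>; it then re-enters the
  line \<open>a \<union> c\<close> behind them and all move back.  This rotates the tokens cyclically without collision;
  \<open>W\<close> is the closed trajectory of a single token, and \<open>\<Sigma>\<close> records the displacement of the line.
\<close>

lemma rotating_loop:
  assumes n: "2 \<le> n" and trip: "tripod_through X y"
  obtains W :: "real \<Rightarrow> 'a" where "continuous_map euclideanreal X W" "\<And>t. W (t + real n) = W t" "W 0 = y"
    "\<forall>t k. W (t + of_int k) = W t \<longrightarrow> int n dvd k"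
proof -
  obtain a b c where arcs: "arc_in X a" "arc_in X b" "arc_in X c" and centre: "a 0 = b 0" "a 0 = c 0"
    and ab: "a ` {0..1} \<inter> b ` {0..1} = {a 0}" and ac: "a ` {0..1} \<inter> c ` {0..1} = {a 0}"
    and bc: "b ` {0..1} \<inter> c ` {0..1} = {a 0}" and y: "y \<in> a ` {0..1}"
    using trip unfolding tripod_through_def by metis
  define L where "L = (\<lambda>s. if 0 \<le> s then a s else c (- s))"
  have L: "continuous_map (top_of_set {-1..1}) X L" "inj_on L {-1..1}"
    "L ` {-1..1} = a ` {0..1} \<union> c ` {0..1}"
    unfolding L_def by (rule bidirectional_arc[OF arcs(1,3) centre(2) ac])+
  have L0: "L 0 = a 0" by (simp add: L_def)
  \<comment> \<open>The spacing: at integer times the n tokens occupy the n equidistant points 0, d,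
    ..., 1 of the leg \<open>a\<close>.\<close>
  define d where "d = 1 / (real n - 1)"
  have nd: "real n * d = 1 + d" and d: "0 < d"
    using n by (auto simp: d_def field_simps)
  \<comment> \<open>In each unit of time the line moves by 1 + d towards \<open>c\<close> and then
    back by 1. The slopes 2 + 2d and -2 have mean d and half difference 2 + d, which are the two
    coefficients.\<close>
  define \<Sigma> where "\<Sigma> t = d * t + (2 + d) * triangle_wave t" for t
  have \<Sigma>_int: "\<Sigma> (t + of_int k) = \<Sigma> t + d * of_int k" for t k
    by (simp add: \<Sigma>_def triangle_wave_add_int algebra_simps)
  have \<Sigma>_up: "\<Sigma> t = 2 * (1 + d) * t" if "t \<in> {0..1/2}" for t
    using that by (simp add: \<Sigma>_def triangle_wave_rising algebra_simps)
  have \<Sigma>_down: "\<Sigma> t = 2 + d - 2 * t" if "t \<in> {1/2..1}" for t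
    using that by (simp add: \<Sigma>_def triangle_wave_falling algebra_simps)
  \<comment> \<open>The constant makes \<open>pos\<close> vanish at t = 1/2, where the token comes
    from \<open>b\<close> onto the line, and at t = n, where it is about to leave for
    \<open>b\<close> again.\<close>
  define pos where "pos t = 1 + d - \<Sigma> t" for t
  \<comment> \<open>Before 1/2 the coordinate can exceed 1, but then the token is on
    \<open>b\<close>. The case t = n is separate because its floor would break the bound d * floor t
    <= 1.\<close>
  have pos_range: "pos t \<in> {-1..1}" if t: "t \<in> {1/2..real n}" for t
  proof (cases "t = real n")
    case True
    have "\<Sigma> (0 + of_int (int n)) = 1 + d" using \<Sigma>_int[of 0 "int n"] \<Sigma>_up[of 0] nd by (simp add: mult.commute)
    then show ?thesis using True by (simp add: pos_def)
  next
    case False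
    define s where "s = t - of_int \<lfloor>t\<rfloor>"
    have s: "0 \<le> s" "s < 1" unfolding s_def by linarith+
    have \<Sigma>t: "\<Sigma> t = \<Sigma> s + d * of_int \<lfloor>t\<rfloor>" using \<Sigma>_int[of s "\<lfloor>t\<rfloor>"] by (simp add: s_def)
    have fl: "0 \<le> \<lfloor>t\<rfloor>" "\<lfloor>t\<rfloor> \<le> int n - 1" using t False by (simp_all, linarith+)
    have "real_of_int \<lfloor>t\<rfloor> \<le> real n - 1" using fl(2) by linarith
    then have "d * of_int \<lfloor>t\<rfloor> \<le> d * (real n - 1)" using d by (intro mult_left_mono) auto
    then have up: "d * of_int \<lfloor>t\<rfloor> \<le> 1" using nd by (simp add: algebra_simps)
    have lo: "0 \<le> d * of_int \<lfloor>t\<rfloor>" using fl d by simp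
    consider "s \<ge> 1/2" | "s < 1/2" by linarith
    then show ?thesis
    proof cases
      case 1 then show ?thesis using \<Sigma>t \<Sigma>_down[of s] s up lo by (auto simp: pos_def)
    next
      case 2
      then have "\<lfloor>t\<rfloor> \<noteq> 0" using t by (auto simp: s_def)
      then have "1 \<le> real_of_int \<lfloor>t\<rfloor>" using fl by linarith
      then have "d \<le> d * of_int \<lfloor>t\<rfloor>" using d by simp
      moreover have "2 * (1 + d) * s \<le> 1 + d" using mult_left_mono[of "2 * s" 1 "1 + d"] 2 d by (simp add: algebra_simps)
      moreover have "0 \<le> 2 * (1 + d) * s" using s d by simp
      ultimately show ?thesis using \<Sigma>t \<Sigma>_up[of s] s up 2 by (auto simp: pos_def)
    qed
  qed
  \<comment> \<open>The quadratic vanishes at 0 and 1/2 and is positive in between: the token leaves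
    the centre along \<open>b\<close> and is back there when the line takes it over.\<close>
  define U where "U t = (if t \<le> 1/2 then b (t * (1 - 2 * t)) else L (pos t))" for t
  have \<beta>: "t * (1 - 2 * t) \<in> {0..1}" if "t \<in> {0..1/2}" for t :: real
    using that by (auto simp: mult_le_one)
  have contU: "continuous_map (top_of_set {0..real n}) X U"
    unfolding U_def
  proof (rule continuous_map_cases_le[where p = "\<lambda>t. t" and q = "\<lambda>_. 1/2" and f = "\<lambda>t. b (t * (1 - 2 * t))" and g = "\<lambda>t. L (pos t)"])
    have "continuous_map (top_of_set {0..1/2}) X (b \<circ> (\<lambda>t. t * (1 - 2 * t)))"
      by (rule continuous_map_compose[of _ "top_of_set {0..1}"])
        (use arcs \<beta> in \<open>auto simp: arc_in_def continuous_map_in_subtopology intro!: continuous_intros\<close>)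
    moreover have "{0..real n} \<inter> {x \<in> topspace (top_of_set {0..real n}). x \<le> 1/2} = {0..1/2}" using n by auto
    ultimately show "continuous_map (subtopology (top_of_set {0..real n}) {x \<in> topspace (top_of_set {0..real n}). x \<le> 1/2}) X (\<lambda>t. b (t * (1 - 2 * t)))"
      unfolding subtopology_subtopology by (simp add: o_def)
    have "continuous_on {1/2..real n} pos"
      unfolding pos_def \<Sigma>_def by (intro continuous_intros)
    then have "continuous_map (top_of_set {1/2..real n}) X (L \<circ> pos)"
      using L pos_range by (intro continuous_map_compose[of _ "top_of_set {-1..1}"])
        (auto simp: continuous_map_in_subtopology)
    moreover have "{0..real n} \<inter> {x \<in> topspace (top_of_set {0..real n}). 1/2 \<le> x} = {1/2..real n}" by auto
    ultimately show "continuous_map (subtopology (top_of_set {0..real n}) {x \<in> topspace (top_of_set {0..real n}). 1/2 \<le> x}) X (\<lambda>t. L (pos t))"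
      unfolding subtopology_subtopology by (simp add: o_def)
    fix x :: real assume x: "x = 1/2"
    have "\<Sigma> (1/2) = 1 + d" using \<Sigma>_up[of "1/2"] by simp
    then have "pos x = 0" by (simp only: x pos_def diff_self)
    then show "b (x * (1 - 2 * x)) = L (pos x)"
      by (simp add: x centre(1)[symmetric] L0)
  qed (auto intro!: continuous_intros)
  have pos_shift: "pos (s + of_int k) = pos s - d * of_int k" for s k by (simp add: pos_def \<Sigma>_int)
  have pos0: "pos 0 = 1 + d" using \<Sigma>_up[of 0] by (simp add: pos_def)
  have U0n: "U 0 = U (real n)"
    using n pos_shift[of 0 "int n"] pos0 nd by (simp add: U_def L0 centre mult.commute)
  obtain W where W: "continuous_map euclideanreal X W" "\<And>t. W (t + real n) = W t"
    and WU: "\<And>t. t \<in> {0..real n} \<Longrightarrow> W t = U t"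
    using periodic_extension[OF contU U0n] n by auto
  \<comment> \<open>The leg \<open>b\<close> meets the line only at the centre, where the parked
    token is only at s = 0 and s = 1/2. At these moments the others have coordinates d(n - j) and
    -dj, which are nonzero.\<close>
  have line_b: "\<not> (U s = U (s + of_int j))" if s: "0 \<le> s" "s \<le> 1/2" and j: "0 < j" "j < int n" for s j
  proof
    assume eq: "U s = U (s + of_int j)"
    have jr: "1 \<le> real_of_int j" "real_of_int j \<le> real n - 1" using j by linarith+
    have ran: "s + of_int j \<in> {1/2..real n}" using s jr by auto
    have Us: "U s = b (s * (1 - 2 * s))" and Uj: "U (s + of_int j) = L (pos (s + of_int j))"
      using s jr by (auto simp: U_def)
    have in_b: "U s \<in> b ` {0..1}" using Us \<beta>[of s] s by auto
    moreover have "U s \<in> a ` {0..1} \<union> c ` {0..1}"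
      unfolding eq Uj using L(3) pos_range[OF ran] by blast
    ultimately have Ua: "U s = a 0" using ab bc by blast
    then have "b (s * (1 - 2 * s)) = b 0" using Us centre by simp
    moreover have "inj_on b {0..1}" using arcs(2) by (simp add: arc_in_def)
    ultimately have "s * (1 - 2 * s) = 0" using \<beta>[of s] s by (intro inj_onD[of b "{0..1}"]) auto
    then have s': "s = 0 \<or> s = 1/2" by auto
    have "L (pos (s + of_int j)) = L 0" unfolding L0 using eq Uj Ua by simp
    from inj_onD[OF L(2) this pos_range[OF ran]] have "pos (s + of_int j) = 0" by simp
    then have pj: "pos s = d * of_int j" by (simp add: pos_shift)
    from s' show False
    proof
      assume "s = 0"
      then have "d * of_int j = 1 + d" using pj pos0 by simp
      then have "d * of_int j = d * real n" using nd by (metis mult.commute)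
      then show False using d jr by simp
    next
      assume s2: "s = 1/2"
      have "\<Sigma> s = 1 + d" unfolding s2 using \<Sigma>_up[of "1/2"] by simp
      then have "d * of_int j = 0" using pj by (simp add: pos_def)
      then show False using d jr by simp
    qed
  qed
  \<comment> \<open>Simultaneous tokens on the line keep the constant distance d |i - j|, whatever
    the displacement.\<close>
  have line_line: "i = j" if s: "0 \<le> s" "s < 1" and i: "0 \<le> i" "i < int n" and j: "0 \<le> j" "j < int n"
    and ran: "1/2 < s + of_int i" "1/2 < s + of_int j" and eq: "U (s + of_int i) = U (s + of_int j)" for s i j
  proof -
    have "real_of_int i \<le> real n - 1" "real_of_int j \<le> real n - 1" using i j by linarith+
    then have "pos (s + of_int i) \<in> {-1..1}" "pos (s + of_int j) \<in> {-1..1}"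
      using ran s by (auto intro!: pos_range simp del: atLeastAtMost_iff) (auto)
    moreover have "L (pos (s + of_int i)) = L (pos (s + of_int j))" using eq ran by (auto simp: U_def)
    ultimately have "pos (s + of_int i) = pos (s + of_int j)" using L(2) by (meson inj_onD)
    then show ?thesis using d by (simp add: pos_shift)
  qed
  have distinct: "i = j" if s: "0 \<le> s" "s < 1" and i: "0 \<le> i" "i < int n" and j: "0 \<le> j" "j < int n"
    and eq: "U (s + of_int i) = U (s + of_int j)" for s i j
  proof -
    consider "s \<le> 1/2" "i = 0" "j = 0" | "s \<le> 1/2" "i = 0" "0 < j" | "s \<le> 1/2" "0 < i" "j = 0"
      | "1/2 < s" | "0 < i" "0 < j" using i j by linarith
    then show ?thesis
    proof cases
      case 2 then show ?thesis using line_b[of s j] s j eq by auto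
    next
      case 3 then show ?thesis using line_b[of s i] s i eq by auto
    next
      case 4 then show ?thesis using line_line[OF s i j _ _ eq] i j by auto
    next
      case 5
      then have "1 \<le> real_of_int i" "1 \<le> real_of_int j" by linarith+
      then show ?thesis using line_line[OF s i j _ _ eq] s by auto
    qed auto
  qed
  \<comment> \<open>Splitting t into integer and fractional parts turns the claim into a comparison
    of two tokens at the same s, where \<open>distinct\<close> applies to residues modulo n.\<close>
  have sep: "int n dvd k" if eq: "W (t + of_int k) = W t" for t k
  proof -
    define q where "q = \<lfloor>t\<rfloor>"
    define s where "s = t - of_int q"
    have s: "0 \<le> s" "s < 1" unfolding s_def q_def by linarith+
    have red: "W (s + of_int m) = U (s + of_int (m mod int n))" for m
    proof -
      have "real_of_int m = real_of_int (m mod int n) + real n * of_int (m div int n)"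
        by (metis mod_mult_div_eq of_int_add of_int_mult of_int_of_nat_eq)
      then have "W (s + of_int m) = W (s + of_int (m mod int n))"
        using periodic_shift_int[of W "real n", OF W(2), of "s + of_int (m mod int n)" "m div int n"] by (simp add: add.assoc)
      moreover have "0 \<le> m mod int n" "m mod int n < int n" using n by auto
      then have "real_of_int (m mod int n) \<le> real n - 1" "0 \<le> real_of_int (m mod int n)" by linarith+
      then have "s + of_int (m mod int n) \<in> {0..real n}" using s by auto
      ultimately show ?thesis using WU by simp
    qed
    have "W (s + of_int (q + k)) = W (s + of_int q)" using eq by (simp add: s_def algebra_simps)
    then have "(q + k) mod int n = q mod int n"
      unfolding red using n by (intro distinct[OF s]) auto
    then show ?thesis by (metis add_diff_cancel_left' mod_eq_dvd_iff)
  qed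
  obtain r where r: "r \<in> {0..1}" "y = a r" using y by blast
  \<comment> \<open>On [1/2, 1] the coordinate rises linearly from 0 to 1, so the token passes
    through y = a r at time (1 + r)/2; starting the clock there gives the value y at 0.\<close>
  define t0 where "t0 = (1 + r) / 2"
  have "pos t0 = r" using \<Sigma>_down[of t0] r by (simp add: pos_def t0_def field_simps)
  moreover have "L r = y" using r by (simp add: L_def)
  moreover have "U t0 = L (pos t0)"
  proof (cases "r = 0")
    case True then show ?thesis using \<open>pos t0 = r\<close> by (simp add: U_def t0_def L0 centre)
  next
    case False then show ?thesis using r by (simp add: U_def t0_def)
  qed
  moreover have "t0 \<in> {0..real n}" using r n by (simp add: t0_def)
  ultimately have Wt0: "W t0 = y" using WU by simp
  show ?thesis
  proof (rule that[of "\<lambda>t. W (t + t0)"])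
    show "continuous_map euclideanreal X (\<lambda>t. W (t + t0))"
    proof (rule continuous_map_compose[of _ euclideanreal "\<lambda>t. t + t0", unfolded o_def])
      show "continuous_map euclideanreal euclideanreal (\<lambda>t. t + t0)" by (auto intro!: continuous_intros)
    qed (rule W(1))
    show "W (t + real n + t0) = W (t + t0)" for t
      using W(2)[of "t + t0"] by (simp add: algebra_simps)
    show "W (0 + t0) = y" using Wt0 by simp
    show "\<forall>t k. W (t + of_int k + t0) = W (t + t0) \<longrightarrow> int n dvd k"
    proof (intro allI impI)
      fix t k assume "W (t + of_int k + t0) = W (t + t0)"
      then show "int n dvd k" using sep[of "t + t0" k] by (simp add: algebra_simps)
    qed
  qed
qed

section \<open>Graph structures\<close>

text \<open>Names the cell structure inside the existential of \<open>finite_graph\<close>, since it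
  has to be subdivided later.\<close>

definition graph_structure :: "'a topology \<Rightarrow> 'a set \<Rightarrow> (real \<Rightarrow> 'a) set \<Rightarrow> bool" where
  "graph_structure X V E \<longleftrightarrow>
     finite V \<and> finite E \<and> V \<subseteq> topspace X \<and>
     (\<forall>e\<in>E. continuous_map (top_of_set {0..1}) X e \<and> e 0 \<in> V \<and> e 1 \<in> V \<and>
            inj_on e {0<..<1} \<and> e ` {0<..<1} \<inter> V = {}) \<and>
     pairwise (\<lambda>e e'. e ` {0<..<1} \<inter> e' ` {0<..<1} = {}) E \<and>
     topspace X = V \<union> (\<Union>e\<in>E. e ` {0<..<1})"

lemma finite_graph_iff_structure:
  "finite_graph X \<longleftrightarrow> Hausdorff_space X \<and> (\<exists>V E. graph_structure X V E)"
  by (simp add: finite_graph_def graph_structure_def)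

lemma closed_unit_interval_split: "{0..1::real} = insert 0 (insert 1 {0<..<1})"
  by auto

text \<open>Injectivity is assumed only on the open interval, because an edge may be a loop; hence
  \<open>arc_in_subarc\<close> does not apply.\<close>

lemma edge_subinterval:
  fixes e :: "real \<Rightarrow> 'a"
  assumes e: "continuous_map (top_of_set {0..1}) X e" "inj_on e {0<..<1}" and st: "0 \<le> s" "s < t" "t \<le> 1"
  shows "continuous_map (top_of_set {0..1}) X (\<lambda>r. e (s + r * (t - s)))"
    and "inj_on (\<lambda>r. e (s + r * (t - s))) {0<..<1}"
    and "(\<lambda>r. e (s + r * (t - s))) ` {0<..<1} = e ` {s<..<t}"
proof -
  let ?p = "\<lambda>r. s + r * (t - s)"
  have bnd: "?p r \<in> {s..t}" if "r \<in> {0..1}" for r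
  proof -
    have "s + r * (t - s) \<le> s + 1 * (t - s)"
      by (rule add_left_mono, rule mult_right_mono) (use that st in auto)
    moreover have "0 \<le> r * (t - s)" using that st by simp
    moreover have "s + 1 * (t - s) = t" by simp
    ultimately show ?thesis by simp
  qed
  have bnd': "?p r \<in> {s<..<t}" if "r \<in> {0<..<1}" for r
  proof -
    have "s + r * (t - s) < s + 1 * (t - s)"
      by (rule add_strict_left_mono, rule mult_strict_right_mono) (use that st in auto)
    moreover have "0 < r * (t - s)" using that st by simp
    moreover have "s + 1 * (t - s) = t" by simp
    ultimately show ?thesis by simp
  qed
  have "continuous_map (top_of_set {0..1}) (top_of_set {0..1}) ?p"
    using bnd st by (fastforce intro!: continuous_intros simp: continuous_map_in_subtopology)
  then show "continuous_map (top_of_set {0..1}) X (\<lambda>r. e (?p r))"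
    using continuous_map_compose[OF _ e(1), of _ ?p] by (simp only: o_def)
  show "inj_on (\<lambda>r. e (?p r)) {0<..<1}"
  proof (rule inj_onI)
    fix r r' assume r: "r \<in> {0<..<1::real}" "r' \<in> {0<..<1}" "e (?p r) = e (?p r')"
    have "?p r = ?p r'"
    proof (rule inj_onD[OF e(2) r(3)])
      show "?p r \<in> {0<..<1}" "?p r' \<in> {0<..<1}"
        using bnd'[OF r(1)] bnd'[OF r(2)] st
        unfolding greaterThanLessThan_iff by (meson order.strict_trans1 order.strict_trans2)+
    qed
    then show "r = r'" using st by simp
  qed
  have "?p ` {0<..<1} = {s<..<t}"
  proof
    show "{s<..<t} \<subseteq> ?p ` {0<..<1}"
    proof
      fix u assume "u \<in> {s<..<t}"
      then show "u \<in> ?p ` {0<..<1}"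
        using st by (intro image_eqI[of _ _ "(u - s) / (t - s)"]) (auto simp: field_simps)
    qed
  qed (use bnd' in blast)
  then show "(\<lambda>r. e (?p r)) ` {0<..<1} = e ` {s<..<t}" by (metis image_image)
qed

text \<open>A point off the vertex set lies on an open edge, which is cut there in two. This turns
  base points, and later an entire invariant set, into vertices.\<close>

lemma graph_structure_insert_vertex:
  assumes G: "graph_structure X V E" and p: "p \<in> topspace X"
  obtains E' where "graph_structure X (insert p V) E'"
proof (cases "p \<in> V")
  case True
  then show ?thesis using G that by (simp add: insert_absorb)
next
  case False
  then obtain e where e: "e \<in> E" "p \<in> e ` {0<..<1}" using G p by (auto simp: graph_structure_def)
  then obtain s where s: "0 < s" "s < 1" "p = e s" by auto
  have ce: "continuous_map (top_of_set {0..1}) X e" "inj_on e {0<..<1}" "e 0 \<in> V" "e 1 \<in> V" "e ` {0<..<1} \<inter> V = {}"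
    using G e by (auto simp: graph_structure_def)
  define e1 where "e1 = (\<lambda>r. e (0 + r * (s - 0)))"
  define e2 where "e2 = (\<lambda>r. e (s + r * (1 - s)))"
  have e1: "continuous_map (top_of_set {0..1}) X e1" "inj_on e1 {0<..<1}" "e1 ` {0<..<1} = e ` {0<..<s}"
    unfolding e1_def using edge_subinterval[OF ce(1,2), of 0 s] s by auto
  have e2: "continuous_map (top_of_set {0..1}) X e2" "inj_on e2 {0<..<1}" "e2 ` {0<..<1} = e ` {s<..<1}"
    unfolding e2_def using edge_subinterval[OF ce(1,2), of s 1] s by auto
  have split: "e ` {0<..<1} = e ` {0<..<s} \<union> {p} \<union> e ` {s<..<1}"
  proof -
    have "{0<..<1} = {0<..<s} \<union> {s} \<union> {s<..<1}" using s by auto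
    then show ?thesis using s by (simp add: image_Un)
  qed
  have inj: "u = v" if "e u = e v" "0 < u" "u < 1" "0 < v" "v < 1" for u v
    using ce(2) that by (auto simp: inj_on_def)
  have d12: "e ` {0<..<s} \<inter> e ` {s<..<1} = {}" "p \<notin> e ` {0<..<s}" "p \<notin> e ` {s<..<1}"
    using s by (auto dest!: inj)
  have disj: "e' ` {0<..<1} \<inter> e ` {0<..<1} = {}" if "e' \<in> E" "e' \<noteq> e" for e'
    using G e that unfolding graph_structure_def pairwise_def by blast
  have old: "continuous_map (top_of_set {0..1}) X e'" "e' 0 \<in> V" "e' 1 \<in> V" "inj_on e' {0<..<1}"
     "e' ` {0<..<1} \<inter> V = {}" if "e' \<in> E" for e'
    using G that by (auto simp: graph_structure_def)
  have "graph_structure X (insert p V) (insert e1 (insert e2 (E - {e})))"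
    unfolding graph_structure_def
  proof (intro conjI ballI)
    show "finite (insert p V)" "finite (insert e1 (insert e2 (E - {e})))" "insert p V \<subseteq> topspace X"
      using G p by (auto simp: graph_structure_def)
    fix f assume f: "f \<in> insert e1 (insert e2 (E - {e}))"
    show "continuous_map (top_of_set {0..1}) X f" "inj_on f {0<..<1}"
      using f e1 e2 old by auto
    show "f 0 \<in> insert p V" "f 1 \<in> insert p V"
      using f s ce old by (auto simp: e1_def e2_def)
    have "f ` {0<..<1} \<inter> V = {}" "p \<notin> f ` {0<..<1}"
    proof -
      show "f ` {0<..<1} \<inter> V = {}"
        using f e1(3) e2(3) split ce(5) old(5) by blast
      show "p \<notin> f ` {0<..<1}"
        using f e1(3) e2(3) d12 disj e(2) by blast
    qed
    then show "f ` {0<..<1} \<inter> insert p V = {}" by blast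
  next
    have "pairwise (\<lambda>e e'. e ` {0<..<1} \<inter> e' ` {0<..<1} = {}) (E - {e})"
      using G unfolding graph_structure_def by (meson Diff_subset pairwise_subset)
    moreover have "e1 ` {0<..<1} \<subseteq> e ` {0<..<1}" "e2 ` {0<..<1} \<subseteq> e ` {0<..<1}"
      unfolding e1(3) e2(3) split by auto
    then have "e1 ` {0<..<1} \<inter> f ` {0<..<1} = {}" "e2 ` {0<..<1} \<inter> f ` {0<..<1} = {}"
      if "f \<in> E" "f \<noteq> e" for f
      using disj[OF that] by blast+
    ultimately show "pairwise (\<lambda>e e'. e ` {0<..<1} \<inter> e' ` {0<..<1} = {}) (insert e1 (insert e2 (E - {e})))"
      unfolding pairwise_insert using d12(1)[folded e1(3) e2(3)] by (auto simp: Int_commute)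
  next
    have "topspace X = V \<union> (\<Union>e\<in>E. e ` {0<..<1})" using G by (simp add: graph_structure_def)
    also have "(\<Union>e\<in>E. e ` {0<..<1}) = e ` {0<..<1} \<union> (\<Union>e\<in>E - {e}. e ` {0<..<1})"
      using e by blast
    finally show "topspace X = insert p V \<union> (\<Union>e\<in>insert e1 (insert e2 (E - {e})). e ` {0<..<1})"
      using split e1(3) e2(3) by auto
  qed
  then show ?thesis by (rule that)
qed

lemma graph_structure_add_vertices:
  assumes "graph_structure X V E" and "finite P" and "P \<subseteq> topspace X"
  obtains E' where "graph_structure X (P \<union> V) E'"
proof -
  from assms(2,3) have "\<exists>E'. graph_structure X (P \<union> V) E'"
  proof (induction P)
    case empty then show ?case using assms(1) by auto
  next
    case (insert p P)
    then obtain E' where "graph_structure X (P \<union> V) E'" by auto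
    then show ?case using graph_structure_insert_vertex[of X "P \<union> V" E' p] insert.prems by auto
  qed
  then show ?thesis using that by blast
qed

section \<open>Path images, circles and arcs in Hausdorff spaces\<close>

lemma closedin_path_image:
  assumes "Hausdorff_space X" "continuous_map (top_of_set {0..1::real}) X e" "compact K" "K \<subseteq> {0..1}"
  shows "closedin X (e ` K)"
proof -
  have "compactin (top_of_set {0..1}) K" using assms(3,4) by (simp add: compactin_subtopology)
  then show ?thesis using assms(1,2) image_compactin compactin_imp_closedin by blast
qed

text \<open>On [0, 1] the loop and the exponential make the same identification, 0 with 1. By
  compactness the loop is a quotient map onto its image, so the exponential descends to a continuous
  bijection onto the circle.\<close>

lemma loop_homeomorphic_circle:
  assumes X: "Hausdorff_space X" and c: "continuous_map (top_of_set {0..1::real}) X c"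
    and loop: "c 0 = c 1" and inj: "inj_on c {0..<1}"
  shows "subtopology X (c ` {0..1}) homeomorphic_space top_of_set (sphere (0::complex) 1)"
proof -
  let ?I = "top_of_set {0..1::real}" and ?C = "top_of_set (sphere (0::complex) 1)"
  let ?Y = "subtopology X (c ` {0..1})"
  define \<zeta> where "\<zeta> t = exp (2 * of_real pi * \<i> * of_real t)" for t :: real
  have sub: "c ` {0..1} \<subseteq> topspace X" using c by (auto simp: continuous_map_def)
  have compY: "compact_space ?Y"
    using c by (simp add: compact_space_subtopology image_compactin[of ?I])
  have cY: "continuous_map ?I ?Y c" using c by (auto simp: continuous_map_in_subtopology)
  have qc: "quotient_map ?I ?Y c"
    using cY X sub by (intro continuous_imp_quotient_map)
      (auto simp: Hausdorff_space_subtopology compact_space_subtopology)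
  have norm\<zeta>: "norm (\<zeta> t) = 1" for t by (simp add: \<zeta>_def)
  have c\<zeta>: "continuous_map ?I ?C \<zeta>"
    unfolding \<zeta>_def by (auto simp: continuous_map_in_subtopology intro!: continuous_intros)
  have surj: "\<zeta> ` {0..1} = sphere 0 1"
  proof
    show "sphere 0 1 \<subseteq> \<zeta> ` {0..1}"
    proof
      fix z :: complex assume "z \<in> sphere 0 1"
      then have "z = exp (\<i> * of_real (Arg2pi z))" using Arg2pi[of z] by (simp add: is_Arg_def)
      then have "z = \<zeta> (Arg2pi z / (2 * pi))" by (simp add: \<zeta>_def mult.commute)
      moreover have "Arg2pi z / (2 * pi) \<in> {0..1}" using Arg2pi[of z] by (auto simp: field_simps)
      ultimately show "z \<in> \<zeta> ` {0..1}" by blast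
    qed
  qed (use norm\<zeta> in auto)
  have \<zeta>_eq: "\<exists>k::int. s = t + of_int k" if eq: "\<zeta> s = \<zeta> t" for s t
  proof -
    obtain k :: int where "2 * of_real pi * \<i> * of_real s = 2 * of_real pi * \<i> * of_real t + of_int (2 * k) * pi * \<i>"
      using eq unfolding \<zeta>_def exp_eq by blast
    then have "2 * of_real pi * \<i> * (of_real s - of_real t - of_int k) = 0"
      by (simp add: algebra_simps)
    then have "complex_of_real s - of_real t - of_int k = 0" by simp
    then have "complex_of_real s = of_real (t + of_int k)" by (simp add: algebra_simps)
    then show ?thesis using of_real_eq_iff by blast
  qed
  have \<zeta>_c: "c s = c t" if "\<zeta> s = \<zeta> t" "s \<in> {0..1}" "t \<in> {0..1}" for s t
  proof -
    obtain k :: int where k: "s = t + of_int k" using \<zeta>_eq \<open>\<zeta> s = \<zeta> t\<close> by blast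
    then have "k = 0 \<or> k = 1 \<or> k = -1" using that(2,3) by auto
    then show ?thesis using loop k that(2,3) by auto
  qed
  have \<zeta>01: "\<zeta> 0 = \<zeta> 1" by (simp add: \<zeta>_def)
  have c_\<zeta>: "\<zeta> s = \<zeta> t" if st: "s \<in> topspace ?I" "t \<in> topspace ?I" and eq: "c s = c t" for s t
  proof -
    \<comment> \<open>Moving 1 to 0 changes neither value and brings parameters into [0, 1), where
      \<open>c\<close> is injective.\<close>
    define \<phi> where "\<phi> u = (if u = 1 then 0 else u)" for u :: real
    have \<phi>: "c (\<phi> u) = c u" "\<zeta> (\<phi> u) = \<zeta> u" for u using loop \<zeta>01 by (auto simp: \<phi>_def)
    have "\<phi> s \<in> {0..<1}" "\<phi> t \<in> {0..<1}" using st by (auto simp: \<phi>_def)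
    then have "\<phi> s = \<phi> t" using inj \<phi>(1) eq by (metis inj_onD)
    then show ?thesis using \<phi>(2) by metis
  qed
  obtain h where h: "continuous_map ?Y ?C h" "h ` topspace ?Y = \<zeta> ` topspace ?I"
    "\<And>x. x \<in> topspace ?I \<Longrightarrow> h (c x) = \<zeta> x"
    using quotient_map_lift_exists[OF qc c\<zeta> c_\<zeta>] by blast
  have "homeomorphic_map ?Y ?C h"
  proof (rule continuous_imp_homeomorphic_map[OF h(1) compY])
    show "Hausdorff_space ?C" by (simp add: Hausdorff_space_subtopology)
    show "h ` topspace ?Y = topspace ?C" using h(2) surj by simp
    show "inj_on h (topspace ?Y)"
    proof (rule inj_onI)
      fix x y assume "x \<in> topspace ?Y" "y \<in> topspace ?Y" and eq: "h x = h y"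
      then obtain s t where st: "s \<in> {0..1}" "t \<in> {0..1}" "x = c s" "y = c t" by auto
      then have "\<zeta> s = \<zeta> t" using h(3)[of s] h(3)[of t] eq by simp
      then show "x = y" using \<zeta>_c st by blast
    qed
  qed
  then show ?thesis by (rule homeomorphic_map_imp_homeomorphic_space)
qed

text \<open>Compactness makes the arc parameter continuous on the image; it is the coordinate used
  to shrink an attached arc.\<close>

lemma arc_in_inverse:
  assumes "Hausdorff_space X" "arc_in X e"
  obtains g where "continuous_map (subtopology X (e ` {0..1})) (top_of_set {0..1}) g"
    "\<And>t. t \<in> {0..1} \<Longrightarrow> g (e t) = t"
proof -
  let ?I = "top_of_set {0..1::real}" and ?Y = "subtopology X (e ` {0..1})"
  have "homeomorphic_map ?I ?Y e"
    using assms arc_in_image_subset[OF assms(2)]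
    by (intro continuous_imp_homeomorphic_map)
      (auto simp: arc_in_def Hausdorff_space_subtopology compact_space_subtopology continuous_map_in_subtopology)
  then obtain g where "homeomorphic_maps ?I ?Y e g" by (auto simp: homeomorphic_map_maps)
  then show ?thesis using that by (auto simp: homeomorphic_maps_def)
qed

lemma arc_homeomorphic_interval:
  assumes "Hausdorff_space X" "arc_in X e" "e ` {0..1} = topspace X"
  shows "X homeomorphic_space top_of_set {0..1::real}"
proof -
  have "homeomorphic_map (top_of_set {0..1::real}) X e"
    using assms by (intro continuous_imp_homeomorphic_map)
      (auto simp: arc_in_def compact_space_subtopology)
  then show ?thesis using homeomorphic_map_imp_homeomorphic_space homeomorphic_space_sym by blast
qed

section \<open>Attaching an arc\<close>

text \<open>Every stage of the homotopy fixes y. Ordinary contractibility would yield free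
  homotopies only, whereas \<open>based_homotopy_classes\<close> needs based ones.\<close>

definition contracts_to :: "'a topology \<Rightarrow> 'a \<Rightarrow> bool" where
  "contracts_to X y \<longleftrightarrow> homotopic_with (\<lambda>k. k y = y) X X (\<lambda>x. x) (\<lambda>_. y)"

text \<open>The arc is first shrunk into its attaching point while \<open>T\<close> stays put, and
  then \<open>T\<close> is contracted. Both homotopies fix y because y lies in
  \<open>T\<close>.\<close>

lemma contracts_to_attach_arc:
  assumes X: "Hausdorff_space X" and T: "closedin X T" "y \<in> T" "contracts_to (subtopology X T) y"
    and e: "arc_in X e" "e 0 \<in> T" "e ` {0<..1} \<inter> T = {}"
  shows "contracts_to (subtopology X (T \<union> e ` {0..1})) y"
proof -
  let ?T' = "T \<union> e ` {0..1}"
  let ?Y = "subtopology X T" and ?Y' = "subtopology X ?T'" and ?I = "top_of_set {0..1::real}"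
  let ?P = "\<lambda>k. k y = y"
  have ce: "continuous_map ?I X e" using e by (simp add: arc_in_def)
  have clo: "closedin X (e ` {0..1})" using closedin_path_image[OF X ce, of "{0..1}"] by simp
  obtain g where g: "continuous_map (subtopology X (e ` {0..1})) ?I g" "\<And>t. t \<in> {0..1} \<Longrightarrow> g (e t) = t"
    using arc_in_inverse[OF X e(1)] by blast
  have TX: "T \<subseteq> topspace X" using T closedin_subset by blast
  have eX: "e ` {0..1} \<subseteq> topspace X" using arc_in_image_subset[OF e(1)] .
  have meet: "x = e 0" if x: "x \<in> T" "x \<in> e ` {0..1}" for x
  proof -
    obtain t where t: "t \<in> {0..1}" "x = e t" using x by blast
    show ?thesis
    proof (cases "t = 0")
      case False
      then have "x \<in> e ` {0<..1}" using t by simp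
      then show ?thesis using e(3) x(1) by blast
    qed (use t in simp)
  qed
  have g0: "g (e 0) = 0" using g(2)[of 0] by simp
  \<comment> \<open>The arc parameter \<open>g x\<close> is scaled by 1 - t. The two formulas agree
    at \<open>e 0\<close>, the only common point of \<open>T\<close> and the arc.\<close>
  define h where "h = (\<lambda>(t, x). if x \<in> T then x else e ((1 - t) * g x))"
  have gI: "g x \<in> {0..1}" if "x \<in> e ` {0..1}" for x using g(2) that by auto
  have pI: "(1 - t) * u \<in> {0..1}" if "t \<in> {0..1}" "u \<in> {0..1}" for t u :: real
    using that by (auto simp: mult_le_one)
  let ?Z = "prod_topology ?I ?Y'"
  have sub: "?T' \<inter> T = T" "?T' \<inter> e ` {0..1} = e ` {0..1}" by auto
  have cont1: "continuous_map (subtopology ?Z ({0..1} \<times> T)) ?Y' snd"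
    unfolding subtopology_Times subtopology_subtopology sub
    using continuous_map_snd[of "subtopology euclideanreal ({0..1} \<inter> {0..1})" ?Y]
    by (auto simp: continuous_map_in_subtopology)
  have contg: "continuous_map (prod_topology ?I (subtopology X (e ` {0..1}))) ?I (\<lambda>z. (1 - fst z) * g (snd z))"
  proof (rule continuous_map_into_subtopology)
    have "continuous_map (prod_topology ?I (subtopology X (e ` {0..1}))) euclideanreal (g \<circ> snd)"
      using g(1) by (intro continuous_map_compose[OF continuous_map_snd]) (auto simp: continuous_map_in_subtopology)
    moreover have "continuous_map (prod_topology ?I (subtopology X (e ` {0..1}))) euclideanreal fst"
      using continuous_map_fst[of ?I] by (metis continuous_map_in_subtopology)
    ultimately show "continuous_map (prod_topology ?I (subtopology X (e ` {0..1}))) euclideanreal (\<lambda>z. (1 - fst z) * g (snd z))"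
      by (intro continuous_map_real_mult continuous_map_diff) (auto simp: o_def)
  qed (use gI pI in auto)
  have "continuous_map ?I ?Y' e" using ce by (auto simp: continuous_map_in_subtopology)
  then have cont2: "continuous_map (subtopology ?Z ({0..1} \<times> e ` {0..1})) ?Y' (\<lambda>z. e ((1 - fst z) * g (snd z)))"
    unfolding subtopology_Times subtopology_subtopology sub Int_absorb
    using continuous_map_compose[OF contg] by (simp add: o_def)
  have conth: "continuous_map ?Z ?Y' h"
  proof (rule pasting_lemma_closed[where I = UNIV and T = "\<lambda>b. {0..1} \<times> (if b then T else e ` {0..1})"
        and f = "\<lambda>b. if b then snd else (\<lambda>z. e ((1 - fst z) * g (snd z)))"])
    show "closedin ?Z ({0..1} \<times> (if b then T else e ` {0..1}))" for b
      using T clo by (auto simp: closedin_prod_Times_iff closedin_subset_topspace closedin_subtopology_Int_closed intro!: closedin_subset_topspace)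
    show "continuous_map (subtopology ?Z ({0..1} \<times> (if b then T else e ` {0..1}))) ?Y' (if b then snd else (\<lambda>z. e ((1 - fst z) * g (snd z))))" for b
      using cont1 cont2 by (cases b) auto
  next
    fix i j :: bool and z
    assume z: "z \<in> topspace ?Z \<inter> {0..1} \<times> (if i then T else e ` {0..1}) \<inter> {0..1} \<times> (if j then T else e ` {0..1})"
    have "snd z = e ((1 - fst z) * g (snd z))" if "snd z \<in> T" "snd z \<in> e ` {0..1}"
      unfolding meet[OF that] g0 by simp
    then show "(if i then snd else (\<lambda>z. e ((1 - fst z) * g (snd z)))) z = (if j then snd else (\<lambda>z. e ((1 - fst z) * g (snd z)))) z"
      using z by (cases i; cases j) auto
  next
    fix z assume z: "z \<in> topspace ?Z"
    show "\<exists>j. j \<in> UNIV \<and> z \<in> {0..1} \<times> (if j then T else e ` {0..1}) \<and> h z = (if j then snd else (\<lambda>z. e ((1 - fst z) * g (snd z)))) z"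
      by (rule exI[of _ "snd z \<in> T"]) (use z in \<open>auto simp: h_def\<close>)
  qed auto
  define \<rho> where "\<rho> x = (if x \<in> T then x else e 0)" for x
  have y: "y \<in> topspace ?Y'" using T TX by auto
  have "homotopic_with ?P ?Y' ?Y' (\<lambda>x. x) \<rho>"
  proof (subst homotopic_with)
    show "\<exists>h. continuous_map ?Z ?Y' h \<and> (\<forall>x\<in>topspace ?Y'. h (0, x) = x) \<and> (\<forall>x\<in>topspace ?Y'. h (1, x) = \<rho> x) \<and> (\<forall>t\<in>{0..1}. h (t, y) = y)"
      using T g(2) by (intro exI[of _ h] conjI conth) (auto simp: h_def \<rho>_def)
  qed (use y in auto)
  moreover have "homotopic_with ?P ?Y' ?Y' \<rho> (\<lambda>_. y)"
  proof -
    have hom: "homotopic_with ?P ?Y ?Y (\<lambda>x. x) (\<lambda>_. y)" using T by (simp add: contracts_to_def)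
    \<comment> \<open>Continuity of the retraction is inherited from the final stage of
      \<open>h\<close>.\<close>
    have "continuous_map ?Y' ?Y' (h \<circ> (\<lambda>x. (1, x)))"
      by (rule continuous_map_compose[OF _ conth]) (auto intro!: continuous_map_pairedI simp: continuous_map_id[unfolded id_def])
    moreover have "h \<circ> (\<lambda>x. (1, x)) = \<rho>" by (auto simp: h_def \<rho>_def)
    ultimately have "continuous_map ?Y' ?Y' \<rho>" by simp
    then have "continuous_map ?Y' ?Y \<rho>"
      using e(2) TX by (auto simp: continuous_map_in_subtopology \<rho>_def)
    from homotopic_with_compose_continuous_map_right[OF hom this, where q = ?P]
    have "homotopic_with ?P ?Y' ?Y ((\<lambda>x. x) \<circ> \<rho>) ((\<lambda>_. y) \<circ> \<rho>)" using T by (auto simp: \<rho>_def)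
    moreover have "continuous_map ?Y ?Y' (\<lambda>x. x)"
      using TX by (auto simp: continuous_map_in_subtopology intro: continuous_map_from_subtopology continuous_map_id[unfolded id_def])
    ultimately have "homotopic_with ?P ?Y' ?Y' ((\<lambda>x. x) \<circ> ((\<lambda>x. x) \<circ> \<rho>)) ((\<lambda>x. x) \<circ> ((\<lambda>_. y) \<circ> \<rho>))"
      by (rule homotopic_with_compose_continuous_map_left) auto
    then show ?thesis by (simp add: o_def)
  qed
  ultimately show ?thesis unfolding contracts_to_def by (rule homotopic_with_trans)
qed

text \<open>Arcs are injective, so a point is never joined to itself; this is why the points are
  assumed distinct below.\<close>

definition joined_within :: "'a topology \<Rightarrow> 'a set \<Rightarrow> 'a \<Rightarrow> 'a \<Rightarrow> bool" where
  "joined_within X T x y \<longleftrightarrow> (\<exists>a. arc_in X a \<and> a 0 = x \<and> a 1 = y \<and> a ` {0..1} \<subseteq> T)"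

lemma joined_within_sym: "joined_within X T x y \<Longrightarrow> joined_within X T y x"
  unfolding joined_within_def
proof (elim exE conjE)
  fix a assume "arc_in X a" "a 0 = x" "a 1 = y" "a ` {0..1} \<subseteq> T"
  then show "\<exists>a. arc_in X a \<and> a 0 = y \<and> a 1 = x \<and> a ` {0..1} \<subseteq> T"
    by (intro exI[of _ "\<lambda>r. a (1 - r)"]) (simp add: arc_in_reverse reverse_image)
qed

lemma joined_within_arc:
  assumes "arc_in X e" "s \<in> {0..1}" "t \<in> {0..1}" "s \<noteq> t" "e ` {0..1} \<subseteq> T"
  shows "joined_within X T (e s) (e t)"
proof -
  have "closed_segment s t \<subseteq> {0..1}" using assms(2,3) by (auto simp: closed_segment_eq_real_ivl)
  then have "e ` closed_segment s t \<subseteq> T" using assms(5) by blast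
  then show ?thesis
    unfolding joined_within_def using arc_in_subarc[OF assms(1-4)]
    by (intro exI[of _ "\<lambda>r. e ((1 - r) * s + r * t)"]) simp
qed

lemma joined_within_attach_arc:
  assumes T: "\<And>x y. x \<in> T \<Longrightarrow> y \<in> T \<Longrightarrow> x \<noteq> y \<Longrightarrow> joined_within X T x y"
    and e: "arc_in X e" "e 0 \<in> T" "e ` {0<..1} \<inter> T = {}"
    and xy: "x \<in> T \<union> e ` {0..1}" "y \<in> T \<union> e ` {0..1}" "x \<noteq> y"
  shows "joined_within X (T \<union> e ` {0..1}) x y"
proof -
  let ?T' = "T \<union> e ` {0..1}"
  \<comment> \<open>An arc in \<open>T\<close> ending at \<open>e 0\<close> is prolonged along
    \<open>e\<close>; beyond \<open>e 0\<close> the latter is outside \<open>T\<close>, so the union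
    is again an arc.\<close>
  have mixed: "joined_within X ?T' x (e t)" if x: "x \<in> T" and t: "t \<in> {0..1}" "x \<noteq> e t" for x t
  proof (cases "t = 0")
    case True
    then show ?thesis using T[of x "e 0"] x t e(2) unfolding joined_within_def by blast
  next
    case False
    show ?thesis
    proof (cases "x = e 0")
      case True
      then show ?thesis using joined_within_arc[OF e(1), of 0 t ?T'] t False by auto
    next
      case ne: False
      obtain a where a: "arc_in X a" "a 0 = e 0" "a 1 = x" "a ` {0..1} \<subseteq> T"
        using T[of "e 0" x] ne e(2) x unfolding joined_within_def by metis
      define b where "b = (\<lambda>r. e ((1 - r) * 0 + r * t))"
      have b: "arc_in X b" "b ` {0..1} = e ` {0..t}"
        using arc_in_subarc[OF e(1), of 0 t] t False by (auto simp: b_def closed_segment_eq_real_ivl)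
      have "{0..t} = insert 0 {0<..t}" using t by auto
      then have "b ` {0..1} = insert (e 0) (e ` {0<..t})" using b(2) by simp
      moreover have "e ` {0<..t} \<inter> T = {}" using e(3) t by fastforce
      ultimately have "a ` {0..1} \<inter> b ` {0..1} = {a 0}"
        using a(2,4) by auto (metis atLeastAtMost_iff image_eqI order_refl zero_le_one)
      then obtain c where c: "arc_in X c" "c 0 = a 1" "c 1 = b 1" "c ` {0..1} = a ` {0..1} \<union> b ` {0..1}"
        using arc_in_join[OF a(1) b(1)] a(2) by (auto simp: b_def)
      have "e ` {0..t} \<subseteq> e ` {0..1}" using t by (intro image_mono) auto
      then show ?thesis unfolding joined_within_def
        using c a b by (intro exI[of _ c]) (auto simp: b_def)
    qed
  qed
  consider "x \<in> T" "y \<in> T" | t where "x \<in> T" "t \<in> {0..1}" "y = e t" | t where "y \<in> T" "t \<in> {0..1}" "x = e t"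
    | s t where "s \<in> {0..1}" "x = e s" "t \<in> {0..1}" "y = e t" using xy by blast
  then show ?thesis
  proof cases
    case 1 then show ?thesis using T[of x y] xy(3) unfolding joined_within_def by blast
  next
    case 2 then show ?thesis using mixed xy(3) by blast
  next
    case 3 then show ?thesis using mixed[of y t] xy(3) joined_within_sym by metis
  next
    case 4 then show ?thesis using joined_within_arc[OF e(1), of s t] xy(3) by auto
  qed
qed

text \<open>The tripod alternative speaks of X, not of \<open>T\<close>, so it persists once it has
  occurred; enlarging \<open>T\<close> can only affect the other two.\<close>

definition point_arc_or_tripod :: "'a topology \<Rightarrow> 'a set \<Rightarrow> 'a \<Rightarrow> bool" where
  "point_arc_or_tripod X T y \<longleftrightarrow>
     T = {y} \<or> (\<exists>a. arc_in X a \<and> a ` {0..1} = T) \<or> tripod_through X y"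

text \<open>An arc attached at an end of an arc prolongs it; attached at an interior point it
  creates a tripod, on which y lies because y is in \<open>T\<close>.\<close>

lemma point_arc_or_tripod_attach_arc:
  assumes T: "point_arc_or_tripod X T y" "y \<in> T"
    and e: "arc_in X e" "e 0 \<in> T" "e ` {0<..1} \<inter> T = {}"
  shows "point_arc_or_tripod X (T \<union> e ` {0..1}) y"
proof -
  let ?T' = "T \<union> e ` {0..1}"
  have eimg: "e ` {0..1} = insert (e 0) (e ` {0<..1})"
  proof -
    have "{0..1::real} = insert 0 {0<..1}" by auto
    then show ?thesis by (metis image_insert)
  qed
  have meet: "S \<inter> e ` {0..1} = {e 0}" if "S \<subseteq> T" "e 0 \<in> S" for S
    unfolding eimg using e(3) that by auto
  have arcT: ?thesis if a: "arc_in X a" "a ` {0..1} = T" "a 0 = e 0" for a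
  proof -
    have "a ` {0..1} \<inter> e ` {0..1} = {a 0}" using meet[of T] a e(2) by auto
    then obtain c where "arc_in X c" "c ` {0..1} = a ` {0..1} \<union> e ` {0..1}"
      using arc_in_join[OF a(1) e(1) a(3)] by blast
    then show ?thesis using a(2) unfolding point_arc_or_tripod_def by blast
  qed
  consider "T = {y}" | a where "arc_in X a" "a ` {0..1} = T" | "tripod_through X y"
    using T(1) unfolding point_arc_or_tripod_def by blast
  then show ?thesis
  proof cases
    case 1
    then have "?T' = e ` {0..1}" using eimg e(2) by auto
    then show ?thesis using e(1) unfolding point_arc_or_tripod_def by blast
  next
    case 2
    note a = this
    obtain t where t: "t \<in> {0..1}" "e 0 = a t" using e(2) a(2) by blast
    consider "t = 0" | "t = 1" | "0 < t" "t < 1" using t(1) by fastforce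
    then show ?thesis
    proof cases
      case 1 then show ?thesis using arcT[OF a] t by simp
    next
      case 2 then show ?thesis
        using arcT[of "\<lambda>r. a (1 - r)"] a t by (simp add: arc_in_reverse reverse_image)
    next
      case 3
      \<comment> \<open>Both halves are parametrised from the branch point, as the legs of a tripod
        start at the centre.\<close>
      define b where "b = (\<lambda>r. a ((1 - r) * t + r * 0))"
      define c where "c = (\<lambda>r. a ((1 - r) * t + r * 1))"
      have b: "arc_in X b" "b ` {0..1} = a ` {0..t}" "b 0 = a t"
        using arc_in_subarc[OF a(1), of t 0] 3 by (auto simp: b_def closed_segment_eq_real_ivl)
      have c: "arc_in X c" "c ` {0..1} = a ` {t..1}" "c 0 = a t"
        using arc_in_subarc[OF a(1), of t 1] 3 by (auto simp: c_def closed_segment_eq_real_ivl)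
      have bcT: "b ` {0..1} \<union> c ` {0..1} = T"
        unfolding b(2) c(2) a(2)[symmetric] image_Un[symmetric] using 3 by (intro arg_cong[where f = "image a"]) auto
      have bc: "b ` {0..1} \<inter> c ` {0..1} = {a t}"
      proof -
        have "{0..t} \<inter> {t..1} = {t}" using 3 by auto
        moreover have "a ` ({0..t} \<inter> {t..1}) = a ` {0..t} \<inter> a ` {t..1}"
          using a(1) 3 unfolding arc_in_def by (intro inj_on_image_Int) auto
        ultimately show ?thesis using b c by simp
      qed
      have be: "b ` {0..1} \<inter> e ` {0..1} = {a t}" and ce: "c ` {0..1} \<inter> e ` {0..1} = {a t}"
        using meet[of "b ` {0..1}"] meet[of "c ` {0..1}"] bcT bc t(2) by auto
      \<comment> \<open>The half that contains y is taken as the first leg.\<close>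
      have "y \<in> b ` {0..1} \<or> y \<in> c ` {0..1}" using T(2) bcT by blast
      then have "tripod_through X y"
      proof
        assume "y \<in> b ` {0..1}"
        then show ?thesis unfolding tripod_through_def
          using b c e(1) bc be ce t(2) by (intro exI[of _ b] exI[of _ c] exI[of _ e]) simp
      next
        assume "y \<in> c ` {0..1}"
        then show ?thesis unfolding tripod_through_def
          using b c e(1) bc be ce t(2) by (intro exI[of _ c] exI[of _ b] exI[of _ e]) (simp add: Int_commute)
      qed
      then show ?thesis unfolding point_arc_or_tripod_def by blast
    qed
  next
    case 3
    then show ?thesis unfolding point_arc_or_tripod_def by blast
  qed
qed

section \<open>Finite trees\<close>

text \<open>Running along \<open>a\<close> and back along \<open>b\<close> gives a loop that is
  injective on [0, 1). In a tree this forbids a further edge with both ends in a tree piece.\<close>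

lemma arcs_with_common_ends_circle:
  assumes X: "Hausdorff_space X" and a: "arc_in X a" and b: "arc_in X b"
    and ends: "a 0 = b 0" "a 1 = b 1" and meet: "a ` {0..1} \<inter> b ` {0..1} \<subseteq> {a 0, a 1}"
  shows "\<exists>S \<subseteq> topspace X. subtopology X S homeomorphic_space top_of_set (sphere (0::complex) 1)"
proof -
  define c where "c t = (if t \<le> 1/2 then a (2 * t) else b (2 - 2 * t))" for t
  have cont: "continuous_map (top_of_set {0..1}) X c"
    unfolding c_def
  proof (rule continuous_map_cases_le[where p = "\<lambda>t. t" and q = "\<lambda>_. 1/2" and f = "\<lambda>t. a (2 * t)" and g = "\<lambda>t. b (2 - 2 * t)"])
    have "continuous_map (top_of_set {0..1/2}) X (a \<circ> (\<lambda>t. 2 * t))"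
      by (rule continuous_map_compose[of _ "top_of_set {0..1}"])
        (use a in \<open>auto simp: arc_in_def continuous_map_in_subtopology intro!: continuous_intros\<close>)
    moreover have "{0..1} \<inter> {x \<in> topspace (top_of_set {0..1}). x \<le> 1/2} = {0..1/2::real}" by auto
    ultimately show "continuous_map (subtopology (top_of_set {0..1}) {x \<in> topspace (top_of_set {0..1}). x \<le> 1/2}) X (\<lambda>t. a (2 * t))"
      unfolding subtopology_subtopology by (simp add: o_def)
    have "continuous_map (top_of_set {1/2..1}) X (b \<circ> (\<lambda>t. 2 - 2 * t))"
      by (rule continuous_map_compose[of _ "top_of_set {0..1}"])
        (use b in \<open>auto simp: arc_in_def continuous_map_in_subtopology intro!: continuous_intros\<close>)
    moreover have "{0..1} \<inter> {x \<in> topspace (top_of_set {0..1}). 1/2 \<le> x} = {1/2..1::real}" by auto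
    ultimately show "continuous_map (subtopology (top_of_set {0..1}) {x \<in> topspace (top_of_set {0..1}). 1/2 \<le> x}) X (\<lambda>t. b (2 - 2 * t))"
      unfolding subtopology_subtopology by (simp add: o_def)
    fix x :: real assume x: "x = 1/2"
    show "a (2 * x) = b (2 - 2 * x)" using ends by (simp add: x)
  qed (auto intro!: continuous_intros)
  have inja: "\<And>s t. a s = a t \<Longrightarrow> s \<in> {0..1} \<Longrightarrow> t \<in> {0..1} \<Longrightarrow> s = t"
    and injb: "\<And>s t. b s = b t \<Longrightarrow> s \<in> {0..1} \<Longrightarrow> t \<in> {0..1} \<Longrightarrow> s = t"
    using a b unfolding arc_in_def by (meson inj_onD)+
  have cross: False if t: "0 \<le> s" "s \<le> 1" "0 < t" "t < 1" and eq: "a s = b t" for s t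
  proof -
    have "a s \<in> a ` {0..1}" "b t \<in> b ` {0..1}" using t by simp_all
    then have "b t = b 0 \<or> b t = b 1" using meet eq ends by auto
    then show False using injb[of t 0] injb[of t 1] t by auto
  qed
  have inj: "inj_on c {0..<1}"
  proof (rule inj_onI)
    fix s t :: real assume st: "s \<in> {0..<1}" "t \<in> {0..<1}" and eq: "c s = c t"
    consider "s \<le> 1/2" "t \<le> 1/2" | "s \<le> 1/2" "t > 1/2" | "s > 1/2" "t \<le> 1/2" | "s > 1/2" "t > 1/2" by linarith
    then show "s = t"
    proof cases
      case 1 then show ?thesis using inja[of "2 * s" "2 * t"] st eq by (simp add: c_def)
    next
      case 2 then show ?thesis using cross[of "2 * s" "2 - 2 * t"] st eq by (simp add: c_def)
    next
      case 3 then show ?thesis using cross[of "2 * t" "2 - 2 * s"] st eq by (simp add: c_def)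
    next
      case 4 then show ?thesis using injb[of "2 - 2 * s" "2 - 2 * t"] st eq by (simp add: c_def)
    qed
  qed
  have "c 0 = c 1" using ends by (simp add: c_def)
  then have "subtopology X (c ` {0..1}) homeomorphic_space top_of_set (sphere (0::complex) 1)"
    by (rule loop_homeomorphic_circle[OF X cont _ inj])
  moreover have "c ` {0..1} \<subseteq> topspace X" using cont by (auto simp: continuous_map_def)
  ultimately show ?thesis by blast
qed

text \<open>Joining by arcs is the invariant that closes up a circle when a further edge has both
  ends in \<open>T\<close>; the contraction and the final alternative are the two conclusions wanted
  for the whole tree.\<close>

definition tree_piece :: "'a topology \<Rightarrow> 'a \<Rightarrow> 'a set \<Rightarrow> bool" where
  "tree_piece X y T \<longleftrightarrow> closedin X T \<and> y \<in> T \<and> contracts_to (subtopology X T) y \<and>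
     (\<forall>x\<in>T. \<forall>z\<in>T. x \<noteq> z \<longrightarrow> joined_within X T x z) \<and> point_arc_or_tripod X T y"

lemma tree_piece_singleton:
  assumes "Hausdorff_space X" "y \<in> topspace X"
  shows "tree_piece X y {y}"
proof -
  have "contracts_to (subtopology X {y}) y"
    unfolding contracts_to_def using assms
    by (intro homotopic_with_equal) (auto simp: continuous_map_id[unfolded id_def])
  then show ?thesis
    using assms by (auto simp: tree_piece_def point_arc_or_tripod_def closedin_Hausdorff_singleton)
qed

lemma tree_piece_attach_arc:
  assumes "Hausdorff_space X" "tree_piece X y T" "arc_in X e" "e 0 \<in> T" "e ` {0<..1} \<inter> T = {}"
  shows "tree_piece X y (T \<union> e ` {0..1})"
proof -
  have "closedin X (e ` {0..1})"
    using closedin_path_image[OF assms(1)] assms(3) by (simp add: arc_in_def)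
  then show ?thesis
    using assms contracts_to_attach_arc[of X T y e] point_arc_or_tripod_attach_arc[of X T y e]
      joined_within_attach_arc[of T X e] unfolding tree_piece_def by (intro conjI ballI impI) blast+
qed

text \<open>A maximal tree piece that is a union of edges is clopen, because an edge sticking out of it either
  can be attached to it or closes up a circle.\<close>

lemma finite_tree_imp_tree_piece:
  assumes tree: "finite_tree X" and y: "y \<in> topspace X"
  shows "tree_piece X y (topspace X)"
proof -
  have X: "Hausdorff_space X" "connected_space X"
    and no_circle: "\<not> (\<exists>S \<subseteq> topspace X. subtopology X S homeomorphic_space top_of_set (sphere (0::complex) 1))"
    using tree by (auto simp: finite_tree_def finite_graph_def)
  obtain V0 E0 where "graph_structure X V0 E0"
    using tree by (auto simp: finite_tree_def finite_graph_iff_structure)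
  \<comment> \<open>With y a vertex, {y} together with some closed edges never meets the interior of
    another edge.\<close>
  then obtain E where G: "graph_structure X (insert y V0) E"
    using graph_structure_insert_vertex y by metis
  define V where "V = insert y V0"
  have fin: "finite V" "finite E" and VX: "V \<subseteq> topspace X"
    and top: "topspace X = V \<union> (\<Union>e\<in>E. e ` {0<..<1})"
    using G by (auto simp: graph_structure_def V_def)
  have edge: "continuous_map (top_of_set {0..1}) X e" "e 0 \<in> V" "e 1 \<in> V" "inj_on e {0<..<1}"
    "e ` {0<..<1} \<inter> V = {}" if "e \<in> E" for e
    using G that unfolding graph_structure_def V_def by simp_all
  have disj: "e ` {0<..<1} \<inter> f ` {0<..<1} = {}" if "e \<in> E" "f \<in> E" "e \<noteq> f" for e f
    using G that unfolding graph_structure_def pairwise_def by blast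
  have closed_edge: "e ` {0..1} = {e 0, e 1} \<union> e ` {0<..<1}" for e :: "real \<Rightarrow> 'a"
    unfolding closed_unit_interval_split by auto
  define U where "U F = {y} \<union> (\<Union>e\<in>F. e ` {0..1})" for F :: "(real \<Rightarrow> 'a) set"
  let ?good = "{F. F \<subseteq> E \<and> tree_piece X y (U F)}"
  have fin_good: "finite ?good" using fin by simp
  have "{} \<in> ?good" using tree_piece_singleton[OF X(1) y] by (simp add: U_def)
  then have "?good \<noteq> {}" by (metis empty_iff)
  from finite_has_maximal[OF fin_good this]
  obtain F where F: "F \<in> ?good" and max: "\<forall>F'\<in>?good. F \<subseteq> F' \<longrightarrow> F = F'" by (rule bexE)
  have piece: "tree_piece X y (U F)" and FE: "F \<subseteq> E" using F by auto
  have U_sub: "U F \<subseteq> V \<union> (\<Union>e\<in>F. e ` {0<..<1})"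
    using edge(2,3) FE unfolding U_def closed_edge by (auto simp: V_def)
  have inner: "e ` {0<..<1} \<inter> U F = {}" if "e \<in> E" "e \<notin> F" for e
  proof -
    have "e ` {0<..<1} \<inter> f ` {0<..<1} = {}" if "f \<in> F" for f
      using disj[of e f] that \<open>e \<in> E\<close> \<open>e \<notin> F\<close> FE by blast
    then show ?thesis using U_sub edge(5)[OF \<open>e \<in> E\<close>] by blast
  qed
  have inj01: "inj_on e {0..1}" if "e \<in> E" "e 0 \<noteq> e 1" for e
  proof -
    have "e 0 \<notin> e ` {0<..<1}" "e 1 \<notin> e ` {0<..<1}" using edge[OF that(1)] by blast+
    then show ?thesis
      using edge(4)[OF that(1)] that(2) unfolding closed_unit_interval_split by auto
  qed
  have outer: "e 0 \<notin> U F \<and> e 1 \<notin> U F" if e: "e \<in> E" "e \<notin> F" for e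
  proof (rule ccontr)
    assume touch: "\<not> (e 0 \<notin> U F \<and> e 1 \<notin> U F)"
    \<comment> \<open>Attaching \<open>e\<close> would enlarge the maximal \<open>F\<close>. The
      reparametrisation \<open>e'\<close> makes this usable for either end of
      \<open>e\<close>.\<close>
    have no_attach: False if e': "arc_in X e'" "e' 0 \<in> U F" "e' ` {0<..1} \<inter> U F = {}" "e' ` {0..1} = e ` {0..1}" for e'
    proof -
      have "tree_piece X y (U F \<union> e' ` {0..1})" by (rule tree_piece_attach_arc[OF X(1) piece e'(1-3)])
      moreover have "U F \<union> e' ` {0..1} = U (insert e F)" unfolding e'(4) by (auto simp: U_def)
      ultimately have "insert e F \<in> ?good" using e FE by auto
      then show False using bspec[OF max, of "insert e F"] e by auto
    qed
    show False
    proof (cases "e 0 = e 1")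
      case True
      have "inj_on e {0..<1}"
      proof -
        have "{0..<1::real} = insert 0 {0<..<1}" by auto
        moreover have "e 0 \<notin> e ` {0<..<1}" using edge[OF e(1)] by blast
        ultimately show ?thesis using edge(4)[OF e(1)] by auto
      qed
      then have "subtopology X (e ` {0..1}) homeomorphic_space top_of_set (sphere (0::complex) 1)"
        using loop_homeomorphic_circle[OF X(1) edge(1)[OF e(1)] True] by blast
      moreover have "e ` {0..1} \<subseteq> topspace X" using edge(1)[OF e(1)] by (auto simp: continuous_map_def)
      ultimately show False using no_circle by blast
    next
      case False
      have arc: "arc_in X e" using edge(1)[OF e(1)] inj01[OF e(1) False] by (simp add: arc_in_def)
      have half: "{0<..1::real} = insert 1 {0<..<1}" by auto
      consider "e 0 \<in> U F" "e 1 \<in> U F" | "e 0 \<in> U F" "e 1 \<notin> U F" | "e 0 \<notin> U F" "e 1 \<in> U F"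
        using touch by blast
      then show False
      proof cases
        case 1
        then obtain a where a: "arc_in X a" "a 0 = e 0" "a 1 = e 1" "a ` {0..1} \<subseteq> U F"
        proof -
          have "joined_within X (U F) (e 0) (e 1)" using piece False 1 by (simp add: tree_piece_def)
          then show ?thesis using that by (auto simp: joined_within_def)
        qed
        have "a ` {0..1} \<inter> e ` {0..1} \<subseteq> U F \<inter> ({e 0, e 1} \<union> e ` {0<..<1})"
          unfolding closed_edge[of e] using a(4) by (rule Int_mono) (rule order_refl)
        also have "\<dots> \<subseteq> {a 0, a 1}" unfolding a(2,3) using inner[OF e] by blast
        finally show False using arcs_with_common_ends_circle[OF X(1) a(1) arc a(2,3)] no_circle by blast
      next
        case 2
        then have "e ` {0<..1} \<inter> U F = {}" using inner[OF e] unfolding half by auto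
        then show False using no_attach[of e] arc 2 by blast
      next
        case 3
        have "(\<lambda>r. 1 - r) ` {0<..1::real} = {0..<1}" by (auto simp: image_iff intro!: bexI[of _ "1 - _"])
        moreover have "{0..<1::real} = insert 0 {0<..<1}" by auto
        ultimately have "(\<lambda>r. e (1 - r)) ` {0<..1} = insert (e 0) (e ` {0<..<1})"
          by (metis image_image image_insert)
        then have "(\<lambda>r. e (1 - r)) ` {0<..1} \<inter> U F = {}" using inner[OF e] 3 by auto
        then show False using no_attach[of "\<lambda>r. e (1 - r)"] arc_in_reverse[OF arc] 3
          by (simp add: reverse_image)
      qed
    qed
  qed
  \<comment> \<open>No remaining edge touches \<open>U F\<close>, so the complement is a finite
    union of points and closed edges, hence closed; connectedness then leaves nothing outside
    \<open>U F\<close>.\<close>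
  have "topspace X - U F = (V - U F) \<union> (\<Union>e\<in>E - F. e ` {0..1})"
  proof
    show "topspace X - U F \<subseteq> (V - U F) \<union> (\<Union>e\<in>E - F. e ` {0..1})"
      unfolding top closed_edge by (auto simp: U_def closed_edge)
    show "(V - U F) \<union> (\<Union>e\<in>E - F. e ` {0..1}) \<subseteq> topspace X - U F"
    proof -
      have "e ` {0..1} \<subseteq> topspace X - U F" if "e \<in> E - F" for e
        using that inner[of e] outer[of e] edge(1)[of e] unfolding closed_edge
        by (auto simp: continuous_map_def)
      then show ?thesis using VX by blast
    qed
  qed
  moreover have "closedin X ((V - U F) \<union> (\<Union>e\<in>E - F. e ` {0..1}))"
  proof (rule closedin_Un)
    show "closedin X (V - U F)" using fin VX by (intro closedin_Hausdorff_finite X) auto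
    show "closedin X (\<Union>e\<in>E - F. e ` {0..1})"
      using fin edge(1) closedin_path_image[OF X(1), of _ "{0..1}"] by (intro closedin_Union) auto
  qed
  ultimately have "openin X (U F)"
    using piece closedin_subset unfolding tree_piece_def
    by (metis Diff_Diff_Int inf.absorb_iff2 openin_diff openin_topspace)
  moreover have "closedin X (U F)" "U F \<noteq> {}" using piece by (auto simp: tree_piece_def)
  ultimately have "U F = topspace X" using X(2) by (auto simp: connected_space_clopen_in)
  then show ?thesis using piece by simp
qed

lemma finite_tree_contracts_to:
  assumes "finite_tree X" "y \<in> topspace X"
  shows "contracts_to X y"
  using finite_tree_imp_tree_piece[OF assms] by (simp add: tree_piece_def)

lemma finite_tree_tripod_through:
  assumes X: "finite_tree X" and y: "y \<in> topspace X" and "topspace X \<noteq> {y}"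
    and "\<not> X homeomorphic_space top_of_set {0..1::real}"
  shows "tripod_through X y"
proof -
  have "Hausdorff_space X" using X by (simp add: finite_tree_def finite_graph_def)
  then show ?thesis
    using finite_tree_imp_tree_piece[OF X y] arc_homeomorphic_interval[of X] assms(3,4)
    unfolding tree_piece_def point_arc_or_tripod_def by blast
qed

section \<open>Edges of a graph\<close>

text \<open>The differences F (j x) - F x telescope to zero along n steps of an orbit, whereas
  without a coincidence connectedness gives them all one sign.\<close>

lemma periodic_map_has_coincidence:
  fixes F :: "'a \<Rightarrow> real"
  assumes Y: "connected_space Y" "topspace Y \<noteq> {}" and j: "continuous_map Y Y j"
    and F: "continuous_map Y euclideanreal F"
    and n: "0 < n" "\<And>x. x \<in> topspace Y \<Longrightarrow> (j ^^ n) x = x"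
  shows "\<exists>x\<in>topspace Y. F (j x) = F x"
proof (rule ccontr)
  assume "\<not> ?thesis"
  then have ne: "F (j x) - F x \<noteq> 0" if "x \<in> topspace Y" for x using that by auto
  let ?D = "\<lambda>x. F (j x) - F x"
  have "continuous_map Y euclideanreal ?D"
    using continuous_map_compose[OF j F] F by (intro continuous_map_diff) (simp_all add: o_def)
  then have "connectedin euclideanreal (?D ` topspace Y)"
    using Y(1) by (metis connectedin_continuous_map_image connectedin_topspace)
  then have conn: "connected (?D ` topspace Y)" by simp
  obtain x where x: "x \<in> topspace Y" using Y(2) by blast
  have iter: "(j ^^ k) x \<in> topspace Y" for k
    using x continuous_map_image_subset_topspace[OF j] by (induction k) auto
  have "(\<Sum>k<n. ?D ((j ^^ k) x)) = (\<Sum>k<n. F ((j ^^ Suc k) x) - F ((j ^^ k) x))" by simp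
  also have "\<dots> = F ((j ^^ n) x) - F x" by (subst sum_lessThan_telescope) simp
  finally have sum0: "(\<Sum>k<n. ?D ((j ^^ k) x)) = 0" using n(2)[OF x] by simp
  have same_sign: "0 \<in> ?D ` topspace Y" if "a \<in> topspace Y" "b \<in> topspace Y" "?D a \<le> 0" "0 \<le> ?D b" for a b
    using connectedD_interval[OF conn, of "?D a" "?D b" 0] that by auto
  consider "\<And>y. y \<in> topspace Y \<Longrightarrow> 0 < ?D y" | "\<And>y. y \<in> topspace Y \<Longrightarrow> ?D y < 0"
    using same_sign ne by (metis (mono_tags, lifting) imageE less_eq_real_def linorder_not_less)
  then show False
  proof cases
    case 1
    then have "0 < (\<Sum>k<n. ?D ((j ^^ k) x))" using n(1) iter by (intro sum_pos) auto
    then show False using sum0 by simp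
  next
    case 2
    then have "(\<Sum>k<n. ?D ((j ^^ k) x)) < (\<Sum>k<n. 0)" using n(1) iter by (intro sum_strict_mono) auto
    then show False using sum0 by simp
  qed
qed

text \<open>The preimage of a closed set consists of finitely many points and finitely many path
  images of compact sets, hence is closed in a Hausdorff space.\<close>

lemma continuous_map_from_finite_paths:
  assumes X: "Hausdorff_space X" and V: "finite V" "V \<subseteq> topspace X" "f ` V \<subseteq> topspace Y" and "finite C"
    and C: "\<And>c. c \<in> C \<Longrightarrow> continuous_map (top_of_set {0..1::real}) X c"
    and fC: "\<And>c. c \<in> C \<Longrightarrow> continuous_map (top_of_set {0..1::real}) Y (f \<circ> c)"
    and top: "topspace X = V \<union> (\<Union>c\<in>C. c ` {0..1})"
  shows "continuous_map X Y f"
  unfolding continuous_map_closedin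
proof (intro conjI allI impI)
  have "f (c t) \<in> topspace Y" if "c \<in> C" "t \<in> {0..1}" for c t
    using continuous_map_image_subset_topspace[OF fC[OF that(1)]] that(2) by auto
  then show "f \<in> topspace X \<rightarrow> topspace Y" using V(3) unfolding top by auto
  fix K assume K: "closedin Y K"
  define H where "H c = {t \<in> {0..1::real}. f (c t) \<in> K}" for c
  have closed: "closedin X (c ` H c)" if "c \<in> C" for c
  proof (rule closedin_path_image[OF X C[OF that]])
    have "closedin (top_of_set {0..1}) (H c)"
      using fC[OF that] K unfolding H_def continuous_map_closedin by auto
    then show "compact (H c)" using closedin_compact compact_Icc by blast
  qed (auto simp: H_def)
  have "{x \<in> topspace X. f x \<in> K} = {x \<in> V. f x \<in> K} \<union> (\<Union>c\<in>C. c ` H c)"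
    unfolding top H_def by blast
  moreover have "closedin X ({x \<in> V. f x \<in> K} \<union> (\<Union>c\<in>C. c ` H c))"
  proof (rule closedin_Un)
    show "closedin X {x \<in> V. f x \<in> K}" using V by (intro closedin_Hausdorff_finite[OF X]) auto
    show "closedin X (\<Union>c\<in>C. c ` H c)" using \<open>finite C\<close> closed by (intro closedin_Union) auto
  qed
  ultimately show "closedin X {x \<in> topspace X. f x \<in> K}" by simp
qed

text \<open>The complement consists of the vertices and the other closed edges, finitely many closed
  sets.\<close>

lemma openin_open_edge:
  assumes X: "Hausdorff_space X" and G: "graph_structure X V E" and e: "e \<in> E"
  shows "openin X (e ` {0<..<1})"
proof -
  have fin: "finite V" "finite E" and VX: "V \<subseteq> topspace X"
    and top: "topspace X = V \<union> (\<Union>e\<in>E. e ` {0<..<1})"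
    using G by (auto simp: graph_structure_def)
  have edge: "continuous_map (top_of_set {0..1}) X f" "f 0 \<in> V" "f 1 \<in> V" "f ` {0<..<1} \<inter> V = {}" if "f \<in> E" for f
    using G that unfolding graph_structure_def by simp_all
  have disj: "e ` {0<..<1} \<inter> f ` {0<..<1} = {}" if "f \<in> E" "e \<noteq> f" for f
    using G that e unfolding graph_structure_def pairwise_def by blast
  have split: "f ` {0..1} = {f 0, f 1} \<union> f ` {0<..<1}" for f :: "real \<Rightarrow> 'a"
    unfolding closed_unit_interval_split by auto
  have sub: "f ` {0<..<1} \<subseteq> topspace X" if "f \<in> E" for f using top that by blast
  have "topspace X - e ` {0<..<1} = V \<union> (\<Union>f\<in>E - {e}. f ` {0..1})"
  proof
    show "topspace X - e ` {0<..<1} \<subseteq> V \<union> (\<Union>f\<in>E - {e}. f ` {0..1})"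
    proof
      fix x assume x: "x \<in> topspace X - e ` {0<..<1}"
      show "x \<in> V \<union> (\<Union>f\<in>E - {e}. f ` {0..1})"
      proof (cases "x \<in> V")
        case False
        then obtain f where "f \<in> E" "x \<in> f ` {0<..<1}" using x unfolding top by blast
        moreover then have "f \<noteq> e" "x \<in> f ` {0..1}" using x unfolding split by blast+
        ultimately show ?thesis by blast
      qed simp
    qed
    have "f ` {0..1} \<subseteq> topspace X - e ` {0<..<1}" if "f \<in> E - {e}" for f
    proof -
      have f: "f \<in> E" "e \<noteq> f" using that by auto
      have "{f 0, f 1} \<subseteq> V" using edge(2,3)[OF f(1)] by simp
      then have "{f 0, f 1} \<subseteq> topspace X - e ` {0<..<1}" using VX edge(4)[OF e] by blast
      moreover have "f ` {0<..<1} \<subseteq> topspace X - e ` {0<..<1}" using sub[OF f(1)] disj[OF f] by blast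
      ultimately show ?thesis unfolding split by (rule Un_least)
    qed
    then show "V \<union> (\<Union>f\<in>E - {e}. f ` {0..1}) \<subseteq> topspace X - e ` {0<..<1}"
      using VX edge(4)[OF e] by blast
  qed
  moreover have "closedin X (V \<union> (\<Union>f\<in>E - {e}. f ` {0..1}))"
  proof (rule closedin_Un)
    show "closedin X V" using fin VX by (intro closedin_Hausdorff_finite X) auto
    show "closedin X (\<Union>f\<in>E - {e}. f ` {0..1})"
      using fin edge(1) closedin_path_image[OF X, of _ "{0..1}"] by (intro closedin_Union) auto
  qed
  ultimately show ?thesis using sub[OF e] by (simp add: openin_closedin)
qed

lemma connectedin_open_edge:
  assumes "graph_structure X V E" "e \<in> E"
  shows "connectedin X (e ` {0<..<1})"
proof -
  have "connectedin (top_of_set {0..1}) {0<..<1::real}"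
    by (auto simp: connectedin_subtopology)
  then show ?thesis
    using assms connectedin_continuous_map_image unfolding graph_structure_def by blast
qed

text \<open>Away from the vertices the open edges are disjoint open sets, so a connected set cannot
  meet two of them. This locates the image of an open edge under the action.\<close>

lemma connected_subset_open_edge:
  assumes X: "Hausdorff_space X" and G: "graph_structure X V E"
    and S: "connectedin X S" "S \<inter> V = {}" and e: "e \<in> E" "S \<inter> e ` {0<..<1} \<noteq> {}"
  shows "S \<subseteq> e ` {0<..<1}"
proof (rule ccontr)
  assume not: "\<not> S \<subseteq> e ` {0<..<1}"
  let ?O = "\<Union>f\<in>E - {e}. f ` {0<..<1}"
  have "openin X ?O" using openin_open_edge[OF X G] by blast
  moreover have cover: "S \<subseteq> e ` {0<..<1} \<union> ?O"
  proof
    fix x assume x: "x \<in> S"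
    have "topspace X = V \<union> (\<Union>e\<in>E. e ` {0<..<1})" using G by (simp add: graph_structure_def)
    then obtain f where "f \<in> E" "x \<in> f ` {0<..<1}"
      using connectedin_subset_topspace[OF S(1)] S(2) x by blast
    then show "x \<in> e ` {0<..<1} \<union> ?O" by blast
  qed
  moreover have "e ` {0<..<1} \<inter> f ` {0<..<1} = {}" if "f \<in> E - {e}" for f
    using G e that unfolding graph_structure_def pairwise_def by blast
  then have "e ` {0<..<1} \<inter> ?O = {}" by blast
  moreover have "?O \<inter> S \<noteq> {}" using not cover by blast
  moreover have "e ` {0<..<1} \<inter> S \<noteq> {}" using e(2) by blast
  ultimately show False
    using S(1) openin_open_edge[OF X G e(1)] unfolding connectedin by (metis inf_bot_left)
qed

text \<open>Valid for loops as well: \<open>e\<close> is a closed map by compactness, and a closed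
  map stays closed when restricted to a full preimage.\<close>

lemma open_edge_inverse:
  assumes X: "Hausdorff_space X" and G: "graph_structure X V E" and e: "e \<in> E"
  obtains g where "continuous_map (subtopology X (e ` {0<..<1})) euclideanreal g"
    "\<And>t. t \<in> {0<..<1} \<Longrightarrow> g (e t) = t"
proof -
  let ?I = "top_of_set {0..1::real}" and ?A = "e ` {0<..<1}"
  have edge: "continuous_map ?I X e" "e 0 \<in> V" "e 1 \<in> V" "inj_on e {0<..<1}" "?A \<inter> V = {}"
    using G e unfolding graph_structure_def by simp_all
  have AX: "?A \<subseteq> topspace X" using G e unfolding graph_structure_def by blast
  \<comment> \<open>End points go to vertices, so no parameter outside the open interval hits the
    open edge.\<close>
  have pre: "{t \<in> topspace ?I. e t \<in> ?A} = {0<..<1}"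
  proof
    show "{t \<in> topspace ?I. e t \<in> ?A} \<subseteq> {0<..<1}"
    proof
      fix t assume t: "t \<in> {t \<in> topspace ?I. e t \<in> ?A}"
      then have "t \<noteq> 0" "t \<noteq> 1" using edge by blast+
      then show "t \<in> {0<..<1}" using t by auto
    qed
  qed auto
  have "closed_map ?I X e" using edge(1) X by (intro continuous_imp_closed_map) (auto simp: compact_space_subtopology)
  then have "closed_map (subtopology ?I {0<..<1}) (subtopology X ?A) e"
    using pre by (rule closed_map_restriction)
  moreover have "continuous_map (subtopology ?I {0<..<1}) (subtopology X ?A) e"
    using edge(1) by (auto simp: continuous_map_in_subtopology continuous_map_from_subtopology)
  moreover have top: "topspace (subtopology ?I {0<..<1}) = {0<..<1}" by auto
  ultimately have "homeomorphic_map (subtopology ?I {0<..<1}) (subtopology X ?A) e"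
    using edge(4) AX by (intro bijective_closed_imp_homeomorphic_map) auto
  then obtain g where "homeomorphic_maps (subtopology ?I {0<..<1}) (subtopology X ?A) e g"
    by (auto simp: homeomorphic_map_maps)
  then have "continuous_map (subtopology X ?A) (subtopology ?I {0<..<1}) g" "\<forall>t\<in>{0<..<1}. g (e t) = t"
    unfolding homeomorphic_maps_def top by blast+
  then show ?thesis using that by (auto simp: continuous_map_in_subtopology)
qed

section \<open>Free cyclic actions on graphs\<close>

text \<open>The label is an exponent carrying a chosen representative of the orbit to the point. It
  is unique only modulo m, so labels shift by k only up to multiples of m.\<close>

lemma equivariant_labelling:
  fixes act :: "int \<Rightarrow> 'a \<Rightarrow> 'a"
  assumes S: "\<And>k x. x \<in> S \<Longrightarrow> act k x \<in> S"
    and add: "\<And>j k x. x \<in> S \<Longrightarrow> act (j + k) x = act j (act k x)"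
    and fixp: "\<And>k x. x \<in> S \<Longrightarrow> act k x = x \<longleftrightarrow> m dvd k"
  obtains \<theta> :: "'a \<Rightarrow> int" where "\<And>k x. x \<in> S \<Longrightarrow> m dvd \<theta> (act k x) - \<theta> x - k"
proof
  define orb where "orb x = range (\<lambda>k. act k x)" for x
  \<comment> \<open>Chosen from the orbit as a set, so that all points of one orbit share the
    representative.\<close>
  define r where "r x = (SOME z. z \<in> orb x)" for x
  define \<theta> where "\<theta> x = (SOME k. act k (r x) = x)" for x
  fix k x assume x: "x \<in> S"
  have zero: "act 0 y = y" if "y \<in> S" for y using fixp[OF that, of 0] by simp
  have orb_shift: "orb (act j x) = orb x" for j
  proof -
    have "act i x \<in> orb (act j x)" for i
      using add[OF x, of "i - j" j] unfolding orb_def by (auto simp: image_iff intro!: exI[of _ "i - j"])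
    moreover have "act i (act j x) \<in> orb x" for i
      using add[OF x, of i j] unfolding orb_def by (auto simp: image_iff intro!: exI[of _ "i + j"])
    ultimately show ?thesis by (auto simp: orb_def)
  qed
  have \<theta>: "act (\<theta> (act j x)) (r x) = act j x" for j
  proof -
    have "r x \<in> orb x" unfolding r_def by (rule someI[of _ "act 0 x"]) (simp add: orb_def)
    then obtain i where i: "r x = act i x" by (auto simp: orb_def)
    have "act (j - i) (r x) = act j x" using add[OF x, of "j - i" i] i by simp
    moreover have "r (act j x) = r x" by (simp add: r_def orb_shift)
    ultimately have "\<exists>k. act k (r (act j x)) = act j x" by auto
    then have "act (\<theta> (act j x)) (r (act j x)) = act j x" unfolding \<theta>_def by (rule someI_ex)
    then show ?thesis by (simp add: \<open>r (act j x) = r x\<close>)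
  qed
  have rS: "r x \<in> S"
  proof -
    have "r x \<in> orb x" unfolding r_def by (rule someI[of _ "act 0 x"]) (simp add: orb_def)
    then show ?thesis using S[OF x] by (auto simp: orb_def)
  qed
  have x0: "act (\<theta> x) (r x) = x" using \<theta>[of 0] zero[OF x] by simp
  have "act (- (k + \<theta> x)) (act (\<theta> (act k x)) (r x)) = act (- (k + \<theta> x)) (act k (act (\<theta> x) (r x)))"
    using \<theta>[of k] x0 by simp
  also have "\<dots> = act (- (k + \<theta> x) + (k + \<theta> x)) (r x)" by (simp only: add[OF rS])
  also have "\<dots> = r x" using zero[OF rS] by simp
  finally have "act (- (k + \<theta> x) + \<theta> (act k x)) (r x) = r x" using add[OF rS] by simp
  then have "m dvd - (k + \<theta> x) + \<theta> (act k x)" using fixp[OF rS] by blast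
  then show "m dvd \<theta> (act k x) - \<theta> x - k" by (simp add: algebra_simps)
qed

text \<open>The cyclic group acts through all integers, with stabilisers nZ, so exponents can be
  added and negated without reduction.\<close>

locale free_cyclic_action =
  fixes X :: "'a topology" and n :: nat and act :: "int \<Rightarrow> 'a \<Rightarrow> 'a"
  assumes n_pos: "0 < n"
    and cont: "continuous_map X X (act k)"
    and act_add: "x \<in> topspace X \<Longrightarrow> act (j + k) x = act j (act k x)"
    and act_fix: "x \<in> topspace X \<Longrightarrow> act k x = x \<longleftrightarrow> int n dvd k"
begin

lemma act_closed: "x \<in> topspace X \<Longrightarrow> act k x \<in> topspace X"
  using cont[of k] by (auto simp: continuous_map_def)

lemma act_0: "x \<in> topspace X \<Longrightarrow> act 0 x = x"
  by (simp add: act_fix)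

lemma act_inverse: "x \<in> topspace X \<Longrightarrow> act (- k) (act k x) = x" "x \<in> topspace X \<Longrightarrow> act k (act (- k) x) = x"
  using act_add[of x "- k" k] act_add[of x k "- k"] by (simp_all add: act_0)

lemma act_mod:
  assumes "x \<in> topspace X" shows "act (k mod int n) x = act k x"
proof -
  have "act (int n * (k div int n)) (act (k mod int n) x) = act (k mod int n) x"
    using act_fix[OF act_closed[OF assms]] by simp
  then show ?thesis using act_add[OF assms, of "int n * (k div int n)" "k mod int n"] by simp
qed

lemma act_funpow: "x \<in> topspace X \<Longrightarrow> (act k ^^ i) x = act (int i * k) x"
proof (induction i)
  case (Suc i)
  then show ?case using act_add[of x k "int i * k"] by (simp add: algebra_simps)
qed (simp add: act_0)

text \<open>Serves twice: for the whole graph, and for an open edge mapped into itself.\<close>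

lemma invariant_connected_set_has_coincidence:
  fixes F :: "'a \<Rightarrow> real"
  assumes S: "connectedin X S" "S \<noteq> {}" "act k ` S \<subseteq> S"
    and F: "continuous_map (subtopology X S) euclideanreal F"
  shows "\<exists>x\<in>S. F (act k x) = F x"
proof -
  have SX: "S \<subseteq> topspace X" using S connectedin_subset_topspace by blast
  then have top: "topspace (subtopology X S) = S" by auto
  have "\<exists>x\<in>topspace (subtopology X S). F (act k x) = F x"
  proof (rule periodic_map_has_coincidence[OF _ _ _ F n_pos])
    show "connected_space (subtopology X S)" using S by (simp add: connectedin_def)
    show "continuous_map (subtopology X S) (subtopology X S) (act k)"
      using S SX cont by (auto simp: continuous_map_in_subtopology continuous_map_from_subtopology)
    show "(act k ^^ n) x = x" if "x \<in> topspace (subtopology X S)" for x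
      using that act_funpow act_fix by auto
  qed (use top S in auto)
  then show ?thesis by (simp only: top)
qed

lemma finite_invariant_set_containing:
  assumes "finite P" "P \<subseteq> topspace X"
  obtains V where "finite V" "P \<subseteq> V" "V \<subseteq> topspace X" "\<And>k x. x \<in> V \<Longrightarrow> act k x \<in> V"
proof
  let ?V = "\<Union>k\<in>{0..<int n}. act k ` P"
  show "finite ?V" using assms by auto
  show "?V \<subseteq> topspace X" using assms act_closed by auto
  show "P \<subseteq> ?V" using n_pos assms(2) act_0 by (force intro!: bexI[of _ 0])
  fix k x assume "x \<in> ?V"
  then obtain j p where p: "p \<in> P" "x = act j p" by auto
  then have "act k x = act ((k + j) mod int n) p" using assms(2) act_add act_mod by auto
  moreover have "(k + j) mod int n \<in> {0..<int n}" using n_pos by auto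
  ultimately show "act k x \<in> ?V" using p by blast
qed

text \<open>The graph structure is subdivided at an invariant finite set of vertices; then the open edges are
  permuted, and this permutation action is free because an invariant edge would contain a fixed
  point.  So \<open>f\<close> may be prescribed along one edge of each orbit, interpolating labels of its ends.\<close>

lemma equivariant_map_of_line:
  fixes W :: "real \<Rightarrow> 'b"
  assumes X: "finite_graph X" and x0: "x0 \<in> topspace X"
    and W: "continuous_map euclideanreal Y W" "\<And>t. W (t + real n) = W t"
  obtains f where "continuous_map X Y f" "f x0 = W 0"
    "\<And>x. x \<in> topspace X \<Longrightarrow> \<exists>t. \<forall>k. f (act k x) = W (t + of_int k)"
proof -
  have H: "Hausdorff_space X" using X by (simp add: finite_graph_def)
  obtain V0 E0 where G0: "graph_structure X V0 E0" using X by (auto simp: finite_graph_iff_structure)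
  then have "finite (insert x0 V0)" "insert x0 V0 \<subseteq> topspace X"
    using x0 by (auto simp: graph_structure_def)
  \<comment> \<open>Invariance keeps images of open edges away from the vertices; having x0 in
    \<open>V\<close> lets its label fix the value at the base point.\<close>
  then obtain V where V: "finite V" "insert x0 V0 \<subseteq> V" "V \<subseteq> topspace X" "\<And>k x. x \<in> V \<Longrightarrow> act k x \<in> V"
    using finite_invariant_set_containing by metis
  obtain E where "graph_structure X (V \<union> V0) E"
    using graph_structure_add_vertices[OF G0 V(1,3)] by blast
  moreover have "V \<union> V0 = V" using V(2) by auto
  ultimately have G: "graph_structure X V E" by simp
  define A where "A e = e ` {0<..<1}" for e :: "real \<Rightarrow> 'a"
  have finE: "finite E" and top: "topspace X = V \<union> (\<Union>e\<in>E. A e)"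
    using G by (simp_all add: graph_structure_def A_def)
  have edge: "continuous_map (top_of_set {0..1}) X e" "e 0 \<in> V" "e 1 \<in> V" "inj_on e {0<..<1}" "A e \<inter> V = {}"
    if "e \<in> E" for e using G that unfolding graph_structure_def A_def by simp_all
  have disj: "e = e'" if "e \<in> E" "e' \<in> E" "A e \<inter> A e' \<noteq> {}" for e e'
    using G that unfolding graph_structure_def pairwise_def A_def by blast
  have A_ne: "A e \<noteq> {}" for e by (auto simp: A_def)
  have AX: "A e \<subseteq> topspace X" if "e \<in> E" for e using top that by blast
  have A_conn: "connectedin X (A e)" if "e \<in> E" for e
    unfolding A_def by (rule connectedin_open_edge[OF G that])
  have act_V: "x \<in> V" if "act k x \<in> V" "x \<in> topspace X" for k x
    using V(4)[OF that(1), of "- k"] act_inverse(1)[OF that(2)] by simp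
  have sub_edge: "act k ` A e \<subseteq> A e'" if "e \<in> E" "e' \<in> E" "act k ` A e \<inter> A e' \<noteq> {}" for k e e'
  proof -
    have "connectedin X (act k ` A e)"
      using connectedin_continuous_map_image[OF cont A_conn[OF that(1)]] .
    moreover have "act k ` A e \<inter> V = {}" using act_V AX[OF that(1)] edge(5)[OF that(1)] by blast
    ultimately show ?thesis
      using connected_subset_open_edge[OF H G _ _ that(2)] that(3) unfolding A_def by blast
  qed
  \<comment> \<open>The reverse inclusion is \<open>sub_edge\<close> for the inverse
    \<open>act (- k)\<close>.\<close>
  have permute: "act k ` A e = A e'" if e: "e \<in> E" "e' \<in> E" "act k ` A e \<inter> A e' \<noteq> {}" for k e e'
  proof
    show sub: "act k ` A e \<subseteq> A e'" by (rule sub_edge[OF e])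
    obtain x where x: "x \<in> A e" "act k x \<in> A e'" using e(3) by blast
    have "act (- k) (act k x) = x" using act_inverse(1) AX[OF e(1)] x(1) by blast
    then have "x \<in> act (- k) ` A e'" using x(2) by (metis imageI)
    then have "act (- k) ` A e' \<inter> A e \<noteq> {}" using x(1) by blast
    then have "act (- k) ` A e' \<subseteq> A e" by (rule sub_edge[OF e(2,1)])
    then have "act k ` act (- k) ` A e' \<subseteq> act k ` A e" by (rule image_mono)
    moreover have "act k ` act (- k) ` A e' = (\<lambda>y. y) ` A e'"
      unfolding image_image using act_inverse(2) AX[OF e(2)] by (intro image_cong) auto
    ultimately show "A e' \<subseteq> act k ` A e" by simp
  qed
  \<comment> \<open>The coordinate \<open>g\<close> is injective on the edge, so a coincidence of
    \<open>g\<close> under \<open>act k\<close> is a fixed point, and freeness applies.\<close>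
  have free_edge: "int n dvd k" if e: "e \<in> E" "act k ` A e = A e" for k e
  proof -
    obtain g where g: "continuous_map (subtopology X (A e)) euclideanreal g" "\<And>t. t \<in> {0<..<1} \<Longrightarrow> g (e t) = t"
      using open_edge_inverse[OF H G e(1)] unfolding A_def by blast
    have "act k ` A e \<subseteq> A e" using e(2) by simp
    then obtain x where x: "x \<in> A e" "g (act k x) = g x"
      using invariant_connected_set_has_coincidence[OF A_conn[OF e(1)] A_ne _ g(1)] by blast
    have "act k x \<in> A e" using x(1) e(2) by blast
    moreover have "y = z" if "y \<in> A e" "z \<in> A e" "g y = g z" for y z
      using that g(2) unfolding A_def by (metis imageE)
    ultimately have "act k x = x" using x by blast
    then show ?thesis using act_fix AX[OF e(1)] x(1) by blast
  qed

  define eqv where "eqv e e' \<longleftrightarrow> e' \<in> E \<and> (\<exists>k. act k ` A e = A e')" for e e'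
  \<comment> \<open>Equivalent edges have the same predicate \<open>eqv e\<close>, hence the same
    choice.\<close>
  define rep where "rep e = (SOME e'. eqv e e')" for e
  have act_image_add: "act (j + k) ` A e = act j ` act k ` A e" if "e \<in> E" for j k e
    unfolding image_image using act_add AX[OF that] by (intro image_cong) auto
  have eqv_rep: "eqv e (rep e)" if "e \<in> E" for e
  proof -
    have "act 0 ` A e = (\<lambda>y. y) ` A e" using act_0 AX[OF that] by (intro image_cong) auto
    then have "act 0 ` A e = A e" by simp
    then have "eqv e e" using that by (auto simp: eqv_def)
    then show ?thesis unfolding rep_def by (rule someI[of "eqv e"])
  qed
  have rep_eq: "rep e = rep e'" if e: "e \<in> E" "eqv e e'" for e e'
  proof -
    obtain k where k: "act k ` A e = A e'" and e': "e' \<in> E" using e by (auto simp: eqv_def)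
    have "act (- k) ` A e' = (\<lambda>y. y) ` A e"
      unfolding k[symmetric] image_image using act_inverse(1) AX[OF e(1)] by (intro image_cong) auto
    then have "act (- k) ` A e' = A e" by simp
    then have "eqv e = eqv e'"
      unfolding eqv_def fun_eq_iff
      using act_image_add[OF e(1)] act_image_add[OF e'] k by metis
    then show ?thesis by (simp add: rep_def)
  qed
  define R where "R = rep ` E"
  have RE: "R \<subseteq> E" using eqv_rep by (auto simp: R_def eqv_def)
  have R_unique: "e = e'" if e: "e \<in> R" "e' \<in> R" "act k ` A e = A e'" for e e' k
  proof -
    have idem: "rep e = e" if "e \<in> R" for e
      using that rep_eq eqv_rep unfolding R_def by (metis imageE)
    have "eqv e e'" using e RE by (auto simp: eqv_def)
    then have "rep e = rep e'" using rep_eq e(1) RE by blast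
    then show ?thesis using idem e by simp
  qed
  have cover: "\<exists>k e t. e \<in> R \<and> t \<in> {0<..<1} \<and> x = act k (e t)" if x: "x \<in> topspace X" "x \<notin> V" for x
  proof -
    obtain e where e: "e \<in> E" "x \<in> A e" using top x by blast
    obtain k where "act k ` A e = A (rep e)" using eqv_rep[OF e(1)] by (auto simp: eqv_def)
    then obtain t where t: "t \<in> {0<..<1}" "act k x = rep e t" using e(2) unfolding A_def by blast
    then have "x = act (- k) (rep e t)" using act_inverse(1)[OF x(1), of k] by simp
    then show ?thesis using t(1) e(1) by (auto simp: R_def)
  qed
  have in_top: "e t \<in> topspace X" if "e \<in> E" "t \<in> {0..1}" for e t
    using continuous_map_image_subset_topspace[OF edge(1)[OF that(1)]] that(2) by auto
  \<comment> \<open>A point off \<open>V\<close> determines its representative edge, its parameter,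
    and its exponent modulo n; hence the values of W below do not depend on choices.\<close>
  have unique: "e = e' \<and> t = t' \<and> int n dvd k - k'"
    if e: "e \<in> R" "e' \<in> R" and t: "t \<in> {0<..<1}" "t' \<in> {0<..<1}" and eq: "act k (e t) = act k' (e' t')" for e e' t t' k k'
  proof -
    have eE: "e \<in> E" "e' \<in> E" using e RE by auto
    have tX: "e t \<in> topspace X" "e' t' \<in> topspace X" using in_top eE t by auto
    have mv: "act (k - k') (e t) = e' t'"
      using act_add[OF tX(1), of "- k'" k] eq act_inverse(1)[OF tX(2)] by simp
    have tA: "e t \<in> A e" "e' t' \<in> A e'" using t by (auto simp: A_def)
    have "e' t' \<in> act (k - k') ` A e" using tA(1) mv by (metis imageI)
    then have "act (k - k') ` A e \<inter> A e' \<noteq> {}" using tA(2) by blast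
    then have img: "act (k - k') ` A e = A e'" by (rule permute[OF eE])
    then have "e = e'" by (rule R_unique[OF e])
    then have dv: "int n dvd k - k'" using free_edge[OF eE(1)] img by simp
    then have "act (k - k') (e t) = e t" using act_fix[OF tX(1)] by blast
    then have "e t = e' t'" using mv by simp
    then have "t = t'" using inj_onD[OF edge(4)[OF eE(1)]] t \<open>e = e'\<close> by blast
    then show ?thesis using \<open>e = e'\<close> dv by simp
  qed

  have W_cong: "W (of_int j + t) = W (of_int k + t)" if dv: "int n dvd j - k" for j k t
  proof -
    obtain i where "j - k = int n * i" using dv by (rule dvdE)
    then have "j = k + int n * i" by simp
    then have "of_int j + t = (of_int k + t) + real n * of_int i" by simp
    then show ?thesis using periodic_shift_int[of W "real n", OF W(2)] by (simp only:)
  qed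
  obtain \<theta>' :: "'a \<Rightarrow> int" where \<theta>': "\<And>k x. x \<in> V \<Longrightarrow> int n dvd \<theta>' (act k x) - \<theta>' x - k"
    using equivariant_labelling[of V act "int n"] V(3,4) act_add act_fix by (metis subsetD)
  \<comment> \<open>Normalised to 0 at x0, so that f x0 = W 0; the congruences survive because the
    constant cancels.\<close>
  define \<theta> where "\<theta> x = \<theta>' x - \<theta>' x0" for x
  have W\<theta>: "W (of_int (\<theta> (act k x)) + t) = W (of_int (\<theta> x + k) + t)" if "x \<in> V" for k x t
    using \<theta>'[OF that, of k] by (intro W_cong) (simp add: \<theta>_def algebra_simps)
  \<comment> \<open>Any integers in the right residue classes can be interpolated, since the values
    are taken in the line.\<close>
  define lab where "lab e t = (1 - t) * of_int (\<theta> (e 0)) + t * of_int (\<theta> (e 1))" for e :: "real \<Rightarrow> 'a" and t :: real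
  \<comment> \<open>The exponent is an arbitrary choice, so \<open>\<phi>\<close> is meaningful only
    modulo n and need not be continuous; only its composite with W is used.\<close>
  define \<phi> :: "'a \<Rightarrow> real" where "\<phi> x = (if x \<in> V then of_int (\<theta> x) else
    (SOME r. \<exists>k e t. e \<in> R \<and> t \<in> {0<..<1} \<and> x = act k (e t) \<and> r = of_int k + lab e t))" for x
  have not_V: "act k (e t) \<notin> V" if "e \<in> R" "t \<in> {0<..<1}" for k e t
  proof
    assume "act k (e t) \<in> V"
    moreover have "e \<in> E" "e t \<in> A e" using that RE by (auto simp: A_def)
    ultimately show False using act_V AX edge(5) by blast
  qed
  have W_open: "W (\<phi> (act k (e t))) = W (of_int k + lab e t)" if e: "e \<in> R" "t \<in> {0<..<1}" for k e t
  proof -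
    let ?P = "\<lambda>r. \<exists>k' e' t'. e' \<in> R \<and> t' \<in> {0<..<1} \<and> act k (e t) = act k' (e' t') \<and> r = of_int k' + lab e' t'"
    have "?P (of_int k + lab e t)" using e by blast
    then have "?P (SOME r. ?P r)" by (rule someI)
    then obtain k' e' t' where r: "e' \<in> R" "t' \<in> {0<..<1}" "act k (e t) = act k' (e' t')"
      "(SOME r. ?P r) = of_int k' + lab e' t'" by blast
    from unique[OF e(1) r(1) e(2) r(2,3)] have u: "e = e'" "t = t'" "int n dvd k - k'" by auto
    have "\<phi> (act k (e t)) = of_int k' + lab e t" using not_V[OF e] r(4) u by (simp add: \<phi>_def)
    then show ?thesis using W_cong[OF u(3)] by simp
  qed
  \<comment> \<open>At the ends, the label of \<open>act k v\<close> agrees modulo n with k plus the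
    label of v. So the interpolation formula extends to the closed edge, which gives continuity at
    the vertices.\<close>
  have W_closed: "W (\<phi> (act k (e t))) = W (of_int k + lab e t)" if e: "e \<in> R" "t \<in> {0..1}" for k e t
  proof -
    have vert: "W (\<phi> (act k v)) = W (of_int k + of_int (\<theta> v))" if "v \<in> V" for v
      using W\<theta>[OF that, of k 0] V(4)[OF that] by (simp add: \<phi>_def add.commute)
    have "e \<in> E" using e RE by auto
    consider "t = 0" | "t = 1" | "t \<in> {0<..<1}" using e(2) by fastforce
    then show ?thesis
      using vert[OF edge(2)[OF \<open>e \<in> E\<close>]] vert[OF edge(3)[OF \<open>e \<in> E\<close>]] W_open[OF e(1)]
      by cases (auto simp: lab_def)
  qed
  define f where "f x = W (\<phi> x)" for x
  show ?thesis
  proof (rule that[of f])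
    show "f x0 = W 0" using V(2) by (simp add: f_def \<phi>_def \<theta>_def)
    show "\<exists>t. \<forall>k. f (act k x) = W (t + of_int k)" if x: "x \<in> topspace X" for x
    proof (cases "x \<in> V")
      case True
      then have "f (act k x) = W (of_int (\<theta> x) + of_int k)" for k
        using W\<theta>[OF True, of k 0] V(4)[OF True] by (simp add: f_def \<phi>_def)
      then show ?thesis by blast
    next
      case False
      then obtain j e t where r: "e \<in> R" "t \<in> {0<..<1}" "x = act j (e t)" using cover x by blast
      have et: "e t \<in> topspace X" using in_top RE r by auto
      have "f (act k x) = W ((of_int j + lab e t) + of_int k)" for k
      proof -
        have "act k x = act (k + j) (e t)" unfolding r(3) using act_add[OF et, of k j] by (rule sym)
        then have "f (act k x) = W (of_int (k + j) + lab e t)"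
          unfolding f_def using W_open[OF r(1,2), of "k + j"] by (simp only:)
        also have "of_int (k + j) + lab e t = (of_int j + lab e t) + of_int k" by simp
        finally show ?thesis .
      qed
      then show ?thesis by blast
    qed
    show "continuous_map X Y f"
    \<comment> \<open>Finitely many translates of the representative edges suffice, because
      exponents matter only modulo n.\<close>
    proof (rule continuous_map_from_finite_paths[OF H V(1,3), where C = "(\<lambda>(k, e). act k \<circ> e) ` ({0..<int n} \<times> R)"])
      have W_top: "W t \<in> topspace Y" for t using W(1) by (auto simp: continuous_map_def)
      then show "f ` V \<subseteq> topspace Y" by (auto simp: f_def)
      show "finite ((\<lambda>(k, e). act k \<circ> e) ` ({0..<int n} \<times> R))" using finE by (simp add: R_def)
      fix c assume "c \<in> (\<lambda>(k, e). act k \<circ> e) ` ({0..<int n} \<times> R)"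
      then obtain k e where c: "c = act k \<circ> e" "e \<in> R" by auto
      then have "e \<in> E" using RE by blast
      then show "continuous_map (top_of_set {0..1}) X c"
        unfolding c(1) using edge(1) cont by (blast intro: continuous_map_compose)
      have "continuous_map (top_of_set {0..1}) Y (W \<circ> (\<lambda>t. of_int k + lab e t))"
        using W(1) by (intro continuous_map_compose[of _ euclideanreal]) (auto simp: lab_def intro!: continuous_intros)
      then show "continuous_map (top_of_set {0..1}) Y (f \<circ> c)"
        by (rule continuous_map_eq) (use W_closed c in \<open>auto simp: f_def\<close>)
    next
      let ?C = "(\<lambda>(k, e). act k \<circ> e) ` ({0..<int n} \<times> R)"
      show "topspace X = V \<union> (\<Union>c\<in>?C. c ` {0..1})"
      proof
        show "topspace X \<subseteq> V \<union> (\<Union>c\<in>?C. c ` {0..1})"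
        proof
          fix x assume x: "x \<in> topspace X"
          show "x \<in> V \<union> (\<Union>c\<in>?C. c ` {0..1})"
          proof (cases "x \<in> V")
            case False
            then obtain k e t where r: "e \<in> R" "t \<in> {0<..<1}" "x = act k (e t)" using cover x by blast
            have "e t \<in> topspace X" using in_top RE r by auto
            then have "x = (act (k mod int n) \<circ> e) t" using r act_mod by simp
            moreover have "act (k mod int n) \<circ> e \<in> ?C" using r n_pos by (intro image_eqI[of _ _ "(k mod int n, e)"]) auto
            moreover have "t \<in> {0..1}" using r by simp
            ultimately show ?thesis by blast
          qed simp
        qed
        have img: "act k (e t) \<in> topspace X" if "e \<in> R" "t \<in> {0..1}" for k e t
          using that in_top RE act_closed by blast
        show "V \<union> (\<Union>c\<in>?C. c ` {0..1}) \<subseteq> topspace X"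
        proof (rule Un_least[OF V(3)], rule UN_least)
          fix c assume "c \<in> ?C"
          then obtain k e where "c = act k \<circ> e" "e \<in> R" by auto
          then show "c ` {0..1} \<subseteq> topspace X" using img by (simp add: image_subset_iff)
        qed
      qed
    qed
  qed
qed

end

section \<open>The Borsuk--Ulam property\<close>

lemma free_cyclic_action_integer_mod_group:
  assumes n: "0 < n" and act: "free_continuous_action (integer_mod_group n) X \<tau>"
  shows "free_cyclic_action X n (\<lambda>k. \<tau> (k mod int n))"
proof -
  let ?G = "integer_mod_group n"
  have ga: "group_action ?G (topspace X) \<tau>"
    and stab: "\<And>x. x \<in> topspace X \<Longrightarrow> stabilizer ?G \<tau> x = {0}"
    and ct: "continuous_map (prod_topology (discrete_topology (carrier ?G)) X) X (\<lambda>(h, x). \<tau> h x)"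
    using act by (auto simp: free_continuous_action_def)
  have carr: "k mod int n \<in> carrier ?G" for k
    using n by (simp add: carrier_integer_mod_group)
  show ?thesis
  proof
    fix k :: int
    have "continuous_map X (prod_topology (discrete_topology (carrier ?G)) X) (\<lambda>x. (k mod int n, x))"
      using carr by (intro continuous_map_pairedI) (auto simp: continuous_map_id[unfolded id_def])
    from continuous_map_compose[OF this ct] show "continuous_map X X (\<tau> (k mod int n))"
      by (simp add: o_def)
  next
    fix x j k assume x: "x \<in> topspace X"
    have "\<tau> ((j mod int n) \<otimes>\<^bsub>?G\<^esub> (k mod int n)) x = \<tau> (j mod int n) (\<tau> (k mod int n) x)"
      using group_action.composition_rule[OF ga x carr carr] .
    then show "\<tau> ((j + k) mod int n) x = \<tau> (j mod int n) (\<tau> (k mod int n) x)"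
      by (simp add: mod_add_eq)
  next
    fix x k assume x: "x \<in> topspace X"
    have "\<tau> (k mod int n) x = x \<longleftrightarrow> k mod int n \<in> stabilizer ?G \<tau> x"
      using carr by (simp add: stabilizer_def)
    then show "\<tau> (k mod int n) x = x \<longleftrightarrow> int n dvd k"
      by (simp add: stab[OF x] dvd_eq_mod_eq_0)
  qed (rule n)
qed

text \<open>Composed with the contraction, either map is deformed to the constant one, and it stays
  based because the contraction fixes y0.\<close>

lemma based_maps_homotopic:
  assumes contr: "contracts_to Y y0" and f: "based_map X x0 Y y0 f" and g: "based_map X x0 Y y0 g"
  shows "homotopic_with (\<lambda>k. k x0 = y0) X Y f g"
proof -
  have to_const: "homotopic_with (\<lambda>k. k x0 = y0) X Y f (\<lambda>_. y0)" if "based_map X x0 Y y0 f" for f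
  proof -
    have "homotopic_with (\<lambda>k. k x0 = y0) X Y ((\<lambda>y. y) \<circ> f) ((\<lambda>_. y0) \<circ> f)"
      by (rule homotopic_with_compose_continuous_map_right[OF contr[unfolded contracts_to_def]])
        (use that in \<open>auto simp: based_map_def\<close>)
    then show ?thesis by (simp add: o_def)
  qed
  show ?thesis using to_const[OF f] to_const[OF g] homotopic_with_symD homotopic_with_trans by metis
qed

text \<open>All based maps are related, and the given f makes their set nonempty, so the quotient
  has exactly one class.\<close>

lemma based_homotopy_classes_contractible:
  assumes "contracts_to Y y0" and "based_map X x0 Y y0 f"
  shows "based_homotopy_classes X x0 Y y0 = {{f. based_map X x0 Y y0 f}}"
proof -
  let ?M = "{f. based_map X x0 Y y0 f}"
  have "based_map X x0 Y y0 f \<and> based_map X x0 Y y0 g \<and> homotopic_with (\<lambda>k. k x0 = y0) X Y f g \<longleftrightarrow>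
      f \<in> ?M \<and> g \<in> ?M" for f g
    unfolding mem_Collect_eq using based_maps_homotopic[OF assms(1)] by metis
  then have "{(f, g). based_map X x0 Y y0 f \<and> based_map X x0 Y y0 g \<and> homotopic_with (\<lambda>k. k x0 = y0) X Y f g} = ?M \<times> ?M"
    by (simp only:) auto
  moreover have "?M // (?M \<times> ?M) = {?M}" using assms(2) by (auto simp: quotient_def)
  ultimately show ?thesis unfolding based_homotopy_classes_def by simp
qed

theorem theorem1p6:
  fixes n :: nat
    and \<Gamma> :: "'a topology" and x0 :: 'a
    and \<tau> :: "int \<Rightarrow> 'a \<Rightarrow> 'a"
  assumes "n \<ge> 2"
    and "finite_graph \<Gamma>" and "connected_space \<Gamma>" and "x0 \<in> topspace \<Gamma>"
    and "free_continuous_action (integer_mod_group n) \<Gamma> \<tau>"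
  shows "(\<forall>y0\<in>{0..1::real}.
            borsuk_ulam_triple (integer_mod_group n) \<Gamma> x0 \<tau> (top_of_set {0..1}) y0) \<and>
         (\<forall>(G :: 'b topology) y0.
            finite_tree G \<longrightarrow> y0 \<in> topspace G \<longrightarrow> (\<forall>p. topspace G \<noteq> {p}) \<longrightarrow>
            \<not> G homeomorphic_space top_of_set {0..1::real} \<longrightarrow>
            (\<exists>\<alpha>. based_homotopy_classes \<Gamma> x0 G y0 = {\<alpha>} \<and>
                 \<not> borsuk_ulam_class (integer_mod_group n) \<Gamma> \<tau> \<alpha> \<and>
                 (\<exists>f\<in>\<alpha>. \<forall>x\<in>topspace \<Gamma>.
                    \<forall>h1\<in>carrier (integer_mod_group n). \<forall>h2\<in>carrier (integer_mod_group n).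
                      h1 \<noteq> h2 \<longrightarrow> f (\<tau> h1 x) \<noteq> f (\<tau> h2 x))))"
proof (intro conjI ballI allI impI)
  let ?Z = "integer_mod_group n"
  interpret free_cyclic_action \<Gamma> n "\<lambda>k. \<tau> (k mod int n)"
    by (rule free_cyclic_action_integer_mod_group) (use assms(1,5) in auto)
  have carr: "carrier ?Z = {0..<int n}" using assms(1) by (simp add: carrier_integer_mod_group)
  {
    fix y0 :: real
    show "borsuk_ulam_triple ?Z \<Gamma> x0 \<tau> (top_of_set {0..1}) y0"
      unfolding borsuk_ulam_triple_def borsuk_ulam_class_def
    proof (intro ballI)
      fix \<alpha> f assume "\<alpha> \<in> based_homotopy_classes \<Gamma> x0 (top_of_set {0..1}) y0" "f \<in> \<alpha>"
      then have "continuous_map \<Gamma> (top_of_set {0..1}) f"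
        by (auto simp: based_homotopy_classes_def quotient_def based_map_def)
      then have f: "continuous_map (subtopology \<Gamma> (topspace \<Gamma>)) euclideanreal f"
        by (simp add: continuous_map_in_subtopology)
      \<comment> \<open>Comparing the generator 1 with 0 is enough; they are distinct elements of
        the carrier because n >= 2.\<close>
      have "\<exists>x\<in>topspace \<Gamma>. f (\<tau> (1 mod int n) x) = f x"
      proof (rule invariant_connected_set_has_coincidence[OF _ _ _ f])
        show "connectedin \<Gamma> (topspace \<Gamma>)" using assms(3) by (simp add: connectedin_topspace)
        show "topspace \<Gamma> \<noteq> {}" using assms(4) by blast
        show "(\<lambda>x. \<tau> (1 mod int n) x) ` topspace \<Gamma> \<subseteq> topspace \<Gamma>"
          by (intro image_subsetI act_closed)
      qed
      then obtain x where x: "x \<in> topspace \<Gamma>" "f (\<tau> (1 mod int n) x) = f x" by (rule bexE)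
      then have "f (\<tau> 1 x) = f (\<tau> 0 x)" using assms(1) act_0[OF x(1)] by simp
      moreover have "1 \<in> carrier ?Z" "0 \<in> carrier ?Z" using assms(1) by (auto simp: carr)
      ultimately show "\<exists>x\<in>topspace \<Gamma>. \<exists>h1\<in>carrier ?Z. \<exists>h2\<in>carrier ?Z. h1 \<noteq> h2 \<and> f (\<tau> h1 x) = f (\<tau> h2 x)"
        using x(1) zero_neq_one by metis
    qed
  next
    fix G :: "'b topology" and y0
    assume G: "finite_tree G" "y0 \<in> topspace G" "\<forall>p. topspace G \<noteq> {p}"
      "\<not> G homeomorphic_space top_of_set {0..1::real}"
    have tripod: "tripod_through G y0"
      by (rule finite_tree_tripod_through[OF G(1,2) spec[OF G(3)] G(4)])
    obtain W where W: "continuous_map euclideanreal G W" "\<And>t. W (t + real n) = W t" "W 0 = y0"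
      "\<forall>t k. W (t + of_int k) = W t \<longrightarrow> int n dvd k"
      using rotating_loop[OF assms(1) tripod] by blast
    obtain f where f: "continuous_map \<Gamma> G f" "f x0 = W 0"
      "\<And>x. x \<in> topspace \<Gamma> \<Longrightarrow> \<exists>t. \<forall>k. f (\<tau> (k mod int n) x) = W (t + of_int k)"
      using equivariant_map_of_line[OF assms(2,4) W(1,2)] by blast
    have based: "based_map \<Gamma> x0 G y0 f" using f W by (simp add: based_map_def)
    \<comment> \<open>On one orbit f takes the values W (t + h), so a collision forces n to divide
      h1 - h2; both lie in [0, n) and would agree.\<close>
    have sep: "f (\<tau> h1 x) \<noteq> f (\<tau> h2 x)"
      if x: "x \<in> topspace \<Gamma>" and h: "h1 \<in> carrier ?Z" "h2 \<in> carrier ?Z" "h1 \<noteq> h2" for x h1 h2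
    proof
      assume eq: "f (\<tau> h1 x) = f (\<tau> h2 x)"
      have hm: "h1 mod int n = h1" "h2 mod int n = h2" using h by (auto simp: carr)
      obtain t where t: "\<And>k. f (\<tau> (k mod int n) x) = W (t + of_int k)" using f(3)[OF x] by blast
      have "W ((t + of_int h2) + of_int (h1 - h2)) = W (t + of_int h2)"
        using t[of h1] t[of h2] eq hm by simp
      then have "int n dvd h1 - h2" using W(4) by blast
      then show False using hm h(3) by (simp add: mod_eq_dvd_iff[symmetric])
    qed
    let ?\<alpha> = "{f. based_map \<Gamma> x0 G y0 f}"
    have "based_homotopy_classes \<Gamma> x0 G y0 = {?\<alpha>}"
      using based_homotopy_classes_contractible[OF finite_tree_contracts_to[OF G(1,2)] based] .
    moreover have "f \<in> ?\<alpha>" using based by simp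
    moreover have "\<not> borsuk_ulam_class ?Z \<Gamma> \<tau> ?\<alpha>"
    proof
      assume "borsuk_ulam_class ?Z \<Gamma> \<tau> ?\<alpha>"
      then obtain x h1 h2 where "x \<in> topspace \<Gamma>" "h1 \<in> carrier ?Z" "h2 \<in> carrier ?Z"
        "h1 \<noteq> h2" "f (\<tau> h1 x) = f (\<tau> h2 x)"
        unfolding borsuk_ulam_class_def using \<open>f \<in> ?\<alpha>\<close> by metis
      then show False using sep by metis
    qed
    ultimately show "\<exists>\<alpha>. based_homotopy_classes \<Gamma> x0 G y0 = {\<alpha>} \<and> \<not> borsuk_ulam_class ?Z \<Gamma> \<tau> \<alpha> \<and>
        (\<exists>f\<in>\<alpha>. \<forall>x\<in>topspace \<Gamma>. \<forall>h1\<in>carrier ?Z. \<forall>h2\<in>carrier ?Z. h1 \<noteq> h2 \<longrightarrow> f (\<tau> h1 x) \<noteq> f (\<tau> h2 x))"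
      by (intro exI[of _ ?\<alpha>] conjI bexI[of _ f] ballI impI sep)
  }
qed

end
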